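(* Let $\Phi=(V_\Phi,l_\Phi,E_\Phi)$ and $\Psi=(V_\Psi,l_\Psi,E_\Psi)$ be composable graphs whose amalgamation $\Phi+\Psi$ has exactly one component. Then $\Phi+\Psi$ provides g-dinaturality if and only if $\Phi+\Psi$ does not include any alternating loop.
   Context: **Graphs.** Let $m,n\ge 0$ and let $M$ be the disjoint union $\{x_1,\ldots,x_m\}+\{y_1,\ldots,y_n\}$, whose elements are called argument places (left-hand side: the $x$'s; right-hand side: the $y$'s). Let $l:M\to\{1,-1\}$; an argument place $u$ is positive if $l(u)=1$ and negative if $l(u)=-1$. Let $G$ be a finite set disjoint from $M$, let $V=M\cup G$ (vertices), and let $E$ be a set of unordered pairs of elements of $V$ (edges). The components are the connected components of $(V,E)$; they are enumerated $1,\ldots,k$ ($k\ge 0$), and $\pi:V\to\{1,\ldots,k\}$ sends a vertex to the number of its component. The triple $(V,l,E)$ is a *graph* iff: (1) every vertex belongs to some edge; (2) $\{x_i,x_j\}\in E$ iff $l(x_i)=-l(x_j)$ and $x_i,x_j$ are in the same component; (3) $\{y_i,y_j\}\in E$ iff $l(y_i)=-l(y_j)$ and $y_i,y_j$ are in the same component; (4) $\{x_i,y_j\}\in E$ iff $l(x_i)=l(y_j)$ and $x_i,y_j$ are in the same component; (5) if a component $K$ includes an edge between two argument places, then $K\cap G=\emptyset$; otherwise $K\cap G=\{g\}$ for some $g\in G$, and $\{u,g\}\in E$ for every $u\in K\setminus\{g\}$. **g-dinatural transformations.** For a (small) category $\mathcal A$ put $\mathcal A^{1}=\mathcal A$, $\mathcal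 A^{-1}=\mathcal A^{op}$. Let $\Gamma=(V,l,E)$ be a graph with $k$ components and let $T:\mathcal A^{l(x_1)}\times\cdots\times\mathcal A^{l(x_m)}\to\mathcal A$, $S:\mathcal A^{l(y_1)}\times\cdots\times\mathcal A^{l(y_n)}\to\mathcal A$ be functors. A family of morphisms $\alpha(A_1,\ldots,A_k):T(A_{\pi(x_1)},\ldots,A_{\pi(x_m)})\to S(A_{\pi(y_1)},\ldots,A_{\pi(y_n)})$ of $\mathcal A$, indexed by all $k$-tuples of objects of $\mathcal A$, is *g-dinatural from $T$ to $S$ with the graph $\Gamma$* if for every $i\in\{1,\ldots,k\}$, all objects $A_q$ ($q\ne i$) and every $f:A\to C$ in $\mathcal A$, $$S(u_1,\ldots,u_n)\circ\alpha(A_1,\ldots,A_{i-1},C,A_{i+1},\ldots,A_k)\circ T(v_1,\ldots,v_m)=S(u'_1,\ldots,u'_n)\circ\alpha(A_1,\ldots,A_{i-1},A,A_{i+1},\ldots,A_k)\circ T(v'_1,\ldots,v'_m),$$ where: if $x_j$ is in component $q\neq i$, then $v_j=v'_j=\mathbf 1_{A_q}$; if $x_j$ is in component $i$ and positive, $v_j=f$, $v'_j=\mathbf 1_A$; if $x_j$ is in component $i$ and negative, $v_j=\mathbf 1_C$, $v'_j=f$; if $y_j$ is in component $q\ne i$, $u_j=u'_j=\mathbf 1_{A_q}$; if $y_j$ is in component $i$ and positive, $u_j=\mathbf 1_C$, $u'_j=f$; if $y_j$ is in component $i$ and negative, $u_j=f$, $u'_j=\mathbf 1_A$. **Amalgamation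 and composition.** Graphs $\Phi$, with argument places $x_1,\ldots,x_m$ (left), $y_1,\ldots,y_n$ (right) and set $G_\Phi$, and $\Psi$, with argument places $y_1,\ldots,y_n$ (left), $z_1,\ldots,z_p$ (right) and set $G_\Psi$, are *composable* if $l_\Phi$ and $l_\Psi$ coincide on $\{y_1,\ldots,y_n\}$ and $G_\Phi\cap G_\Psi=\emptyset$. Their numbers of components are $k_\Phi,k_\Psi$. The amalgamation $\Phi+\Psi$ is $(V_\Phi\cup V_\Psi,\,E_\Phi+E_\Psi)$, where $E_\Phi+E_\Psi$ is the disjoint union (a pair $\{y_i,y_j\}$ in both $E_\Phi$ and $E_\Psi$ counts as two edges); its components are its connected components. When $\Phi+\Psi$ has one component, the composition $\Psi\Phi=(V,l,E)$ is the following graph with left-hand side argument places $x_1,\ldots,x_m$ and right-hand side argument places $z_1,\ldots,z_p$, with signs from $l_\Phi$, $l_\Psi$: if all $x$'s have one and the same sign and all $z$'s have the opposite sign (this includes such cases with $m=0$ or $p=0$), then $V=\{x_1,\ldots,x_m,z_1,\ldots,z_p\}\cup\{g\}$ and $E$ consists of all $\{x_i,g\}$ and all $\{z_j,g\}$ (if $m=p=0$ this is the single vertex $g$); otherwise $V=\{x_1,\ldots,x_m,z_1,\ldots,z_p\}$ and $E$ consists of the pairs $\{x_i,x_j\}$ with opposite signs, $\{z_i,z_j\}$ with opposite signs, and $\{x_i,z_j\}$ with equal signs. In all cases $\Psi\Phi$ has exactly one component. **Providing g-dinaturality.** Assume $\Phi+\Psi$ has one component. It *provides g-dinaturality* if for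 every category $\mathcal A$, all functors $F:\mathcal A^{l_\Phi(x_1)}\times\cdots\times\mathcal A^{l_\Phi(x_m)}\to\mathcal A$, $G:\mathcal A^{l_\Phi(y_1)}\times\cdots\times\mathcal A^{l_\Phi(y_n)}\to\mathcal A$, $H:\mathcal A^{l_\Psi(z_1)}\times\cdots\times\mathcal A^{l_\Psi(z_p)}\to\mathcal A$, and all g-dinatural $\gamma$ from $F$ to $G$ with the graph $\Phi$ and $\delta$ from $G$ to $H$ with the graph $\Psi$, the composition $\delta\gamma=\{\delta(A,\ldots,A)\circ\gamma(A,\ldots,A)\mid A\in Ob(\mathcal A)\}$ (with $A$ repeated $k_\Psi$ and $k_\Phi$ times respectively) is g-dinatural from $F$ to $H$ with the graph $\Psi\Phi$. **Alternating loops.** An alternating chain in $\Phi+\Psi$ is a sequence of vertices $v_1,\ldots,v_q$ together with a nonempty sequence of edges $e_1,\ldots,e_{q-1}$ of $\Phi+\Psi$ such that $e_i=\{v_i,v_{i+1}\}$ for each $i$ and for each pair of adjacent edges $e_i,e_{i+1}$ one belongs to $E_\Phi$ and the other to $E_\Psi$. It is an alternating loop if $v_1=v_q$. *)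

theory Defs
  imports Main
begin

section \<open>Categories and functors\<close>

record ('o, 'm) cat =
  Ob :: "'o set"
  Mor :: "'m set"
  Dom :: "'m \<Rightarrow> 'o"
  Cod :: "'m \<Rightarrow> 'o"
  Idm :: "'o \<Rightarrow> 'm"
  Cmp :: "'m \<Rightarrow> 'm \<Rightarrow> 'm"  \<comment> \<open>\<open>Cmp C g f\<close> is \<open>g\<close> after \<open>f\<close>\<close>

definition Hom :: "('o, 'm) cat \<Rightarrow> 'o \<Rightarrow> 'o \<Rightarrow> 'm set" where
  "Hom C A B = {f \<in> Mor C. Dom C f = A \<and> Cod C f = B}"

definition is_category :: "('o, 'm) cat \<Rightarrow> bool" where
  "is_category C \<longleftrightarrow>
     (\<forall>f \<in> Mor C. Dom C f \<in> Ob C \<and> Cod C f \<in> Ob C) \<and>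
     (\<forall>A \<in> Ob C. Idm C A \<in> Hom C A A) \<and>
     (\<forall>f \<in> Mor C. \<forall>g \<in> Mor C. Cod C f = Dom C g \<longrightarrow>
        Cmp C g f \<in> Hom C (Dom C f) (Cod C g)) \<and>
     (\<forall>f \<in> Mor C. Cmp C f (Idm C (Dom C f)) = f \<and> Cmp C (Idm C (Cod C f)) f = f) \<and>
     (\<forall>f \<in> Mor C. \<forall>g \<in> Mor C. \<forall>h \<in> Mor C. Cod C f = Dom C g \<longrightarrow> Cod C g = Dom C h \<longrightarrow>
        Cmp C h (Cmp C g f) = Cmp C (Cmp C h g) f)"

definition op_cat :: "('o, 'm) cat \<Rightarrow> ('o, 'm) cat" where
  "op_cat C = \<lparr>Ob = Ob C, Mor = Mor C, Dom = Cod C, Cod = Dom C, Idm = Idm C,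
                Cmp = (\<lambda>g f. Cmp C f g)\<rparr>"

definition signed_cat :: "('o, 'm) cat \<Rightarrow> int \<Rightarrow> ('o, 'm) cat" where
  "signed_cat C s = (if s = 1 then C else op_cat C)"

text \<open>The product of a finite list of categories: objects and morphisms are tuples, represented as
  lists of the same length. The product of the empty list is the terminal category.\<close>

definition prod_cat :: "('o, 'm) cat list \<Rightarrow> ('o list, 'm list) cat" where
  "prod_cat Cs = \<lparr>
     Ob = {As. length As = length Cs \<and> (\<forall>j < length Cs. As ! j \<in> Ob (Cs ! j))},
     Mor = {fs. length fs = length Cs \<and> (\<forall>j < length Cs. fs ! j \<in> Mor (Cs ! j))},
     Dom = (\<lambda>fs. map2 Dom Cs fs),
     Cod = (\<lambda>fs. map2 Cod Cs fs),
     Idm = (\<lambda>As. map2 Idm Cs As),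
     Cmp = (\<lambda>gs fs. map2 (\<lambda>C (g, f). Cmp C g f) Cs (zip gs fs))\<rparr>"

record ('o1, 'm1, 'o2, 'm2) functr =
  omap :: "'o1 \<Rightarrow> 'o2"
  mmap :: "'m1 \<Rightarrow> 'm2"

definition is_functor ::
  "('o1, 'm1) cat \<Rightarrow> ('o2, 'm2) cat \<Rightarrow> ('o1, 'm1, 'o2, 'm2) functr \<Rightarrow> bool" where
  "is_functor C D T \<longleftrightarrow>
     (\<forall>A \<in> Ob C. omap T A \<in> Ob D) \<and>
     (\<forall>f \<in> Mor C. mmap T f \<in> Hom D (omap T (Dom C f)) (omap T (Cod C f))) \<and>
     (\<forall>A \<in> Ob C. mmap T (Idm C A) = Idm D (omap T A)) \<and>
     (\<forall>f \<in> Mor C. \<forall>g \<in> Mor C. Cod C f = Dom C g \<longrightarrow>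
        mmap T (Cmp C g f) = Cmp D (mmap T g) (mmap T f))"


section \<open>Graphs\<close>

text \<open>Argument places are listed in order, left-hand ones in \<open>lhs\<close> and right-hand ones in \<open>rhs\<close>.
  The enumeration of the components is part of the data; it starts at 0, so that the components
  are \<open>0, \<dots>, ncomp - 1\<close> and \<open>cidx\<close> is the map \<open>\<pi>\<close>. The values of \<open>lab\<close> and \<open>cidx\<close> outside their
  intended domains are irrelevant.\<close>

record 'v graph =
  lhs :: "'v list"
  rhs :: "'v list"
  inner :: "'v set"
  lab :: "'v \<Rightarrow> int"
  edges :: "'v set set"
  ncomp :: nat
  cidx :: "'v \<Rightarrow> nat"

definition args :: "'v graph \<Rightarrow> 'v set" where
  "args \<Gamma> = set (lhs \<Gamma>) \<union> set (rhs \<Gamma>)"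

definition verts :: "'v graph \<Rightarrow> 'v set" where
  "verts \<Gamma> = args \<Gamma> \<union> inner \<Gamma>"

definition linked :: "'v set \<Rightarrow> 'v set set \<Rightarrow> ('v \<times> 'v) set" where
  "linked V E = {(u, v). u \<in> V \<and> v \<in> V \<and> (u, v) \<in> {(a, b). {a, b} \<in> E}\<^sup>*}"

definition components :: "'v set \<Rightarrow> 'v set set \<Rightarrow> 'v set set" where
  "components V E = V // linked V E"

text \<open>An edge is an unordered pair of two different vertices.\<close>

definition is_graph :: "'v graph \<Rightarrow> bool" where
  "is_graph \<Gamma> \<longleftrightarrow>
     distinct (lhs \<Gamma> @ rhs \<Gamma>) \<and> finite (inner \<Gamma>) \<and> inner \<Gamma> \<inter> args \<Gamma> = {} \<and>
     (\<forall>u \<in> args \<Gamma>. lab \<Gamma> u \<in> {1, -1}) \<and>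
     (\<forall>e \<in> edges \<Gamma>. \<exists>u \<in> verts \<Gamma>. \<exists>v \<in> verts \<Gamma>. u \<noteq> v \<and> e = {u, v}) \<and>
     cidx \<Gamma> ` verts \<Gamma> = {..<ncomp \<Gamma>} \<and>
     (\<forall>u \<in> verts \<Gamma>. \<forall>v \<in> verts \<Gamma>.
        cidx \<Gamma> u = cidx \<Gamma> v \<longleftrightarrow> (u, v) \<in> linked (verts \<Gamma>) (edges \<Gamma>)) \<and>
     (\<forall>u \<in> verts \<Gamma>. \<exists>e \<in> edges \<Gamma>. u \<in> e) \<and>
     (\<forall>u \<in> set (lhs \<Gamma>). \<forall>v \<in> set (lhs \<Gamma>).
        {u, v} \<in> edges \<Gamma> \<longleftrightarrow> lab \<Gamma> u = - lab \<Gamma> v \<and> (u, v) \<in> linked (verts \<Gamma>) (edges \<Gamma>)) \<and>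
     (\<forall>u \<in> set (rhs \<Gamma>). \<forall>v \<in> set (rhs \<Gamma>).
        {u, v} \<in> edges \<Gamma> \<longleftrightarrow> lab \<Gamma> u = - lab \<Gamma> v \<and> (u, v) \<in> linked (verts \<Gamma>) (edges \<Gamma>)) \<and>
     (\<forall>u \<in> set (lhs \<Gamma>). \<forall>v \<in> set (rhs \<Gamma>).
        {u, v} \<in> edges \<Gamma> \<longleftrightarrow> lab \<Gamma> u = lab \<Gamma> v \<and> (u, v) \<in> linked (verts \<Gamma>) (edges \<Gamma>)) \<and>
     (\<forall>K \<in> components (verts \<Gamma>) (edges \<Gamma>).
        if \<exists>u \<in> K \<inter> args \<Gamma>. \<exists>v \<in> K \<inter> args \<Gamma>. {u, v} \<in> edges \<Gamma>
        then K \<inter> inner \<Gamma> = {}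
        else \<exists>g \<in> inner \<Gamma>. K \<inter> inner \<Gamma> = {g} \<and> (\<forall>u \<in> K - {g}. {u, g} \<in> edges \<Gamma>))"


section \<open>g-dinatural transformations\<close>

definition places_cat :: "('o, 'm) cat \<Rightarrow> ('v \<Rightarrow> int) \<Rightarrow> 'v list \<Rightarrow> ('o list, 'm list) cat" where
  "places_cat A l us = prod_cat (map (\<lambda>u. signed_cat A (l u)) us)"

definition objs :: "'v graph \<Rightarrow> 'o list \<Rightarrow> 'v list \<Rightarrow> 'o list" where
  "objs \<Gamma> As us = map (\<lambda>u. As ! cidx \<Gamma> u) us"

text \<open>The tuple of morphisms which at the places outside component \<open>i\<close> has identities, at the positive
  places of component \<open>i\<close> has \<open>p\<close>, and at the negative ones \<open>n\<close>.\<close>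

definition mors ::
  "('o, 'm) cat \<Rightarrow> 'v graph \<Rightarrow> 'o list \<Rightarrow> nat \<Rightarrow> 'm \<Rightarrow> 'm \<Rightarrow> 'v list \<Rightarrow> 'm list" where
  "mors A \<Gamma> As i p n us =
     map (\<lambda>u. if cidx \<Gamma> u \<noteq> i then Idm A (As ! cidx \<Gamma> u) else if lab \<Gamma> u = 1 then p else n) us"

text \<open>In the following definition the \<open>i\<close>-th entry of \<open>As\<close> in the main equation plays no role: it is
  overwritten by the source or the target of \<open>f\<close>.\<close>

definition g_dinatural ::
  "('o, 'm) cat \<Rightarrow> 'v graph \<Rightarrow> ('o list, 'm list, 'o, 'm) functr \<Rightarrow>
     ('o list, 'm list, 'o, 'm) functr \<Rightarrow> ('o list \<Rightarrow> 'm) \<Rightarrow> bool" where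
  "g_dinatural A \<Gamma> T S \<alpha> \<longleftrightarrow>
     (\<forall>As. length As = ncomp \<Gamma> \<and> set As \<subseteq> Ob A \<longrightarrow>
        \<alpha> As \<in> Hom A (omap T (objs \<Gamma> As (lhs \<Gamma>))) (omap S (objs \<Gamma> As (rhs \<Gamma>)))) \<and>
     (\<forall>i < ncomp \<Gamma>. \<forall>As. \<forall>f \<in> Mor A. length As = ncomp \<Gamma> \<and> set As \<subseteq> Ob A \<longrightarrow>
        (let a = Dom A f; c = Cod A f in
          Cmp A (mmap S (mors A \<Gamma> As i (Idm A c) f (rhs \<Gamma>)))
            (Cmp A (\<alpha> (As[i := c]))
                   (mmap T (mors A \<Gamma> As i f (Idm A c) (lhs \<Gamma>)))) =
          Cmp A (mmap S (mors A \<Gamma> As i f (Idm A a) (rhs \<Gamma>)))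
            (Cmp A (\<alpha> (As[i := a]))
                   (mmap T (mors A \<Gamma> As i (Idm A a) f (lhs \<Gamma>))))))"


section \<open>Amalgamation and composition\<close>

text \<open>The places \<open>y\<^sub>1, \<dots>, y\<^sub>n\<close> are literally shared, and there are no other common vertices:
  the last equation includes \<open>inner \<Phi> \<inter> inner \<Psi> = {}\<close> and the disjointness of the \<open>x\<close>'s, the \<open>z\<close>'s
  and all inner vertices.\<close>

definition composable :: "'v graph \<Rightarrow> 'v graph \<Rightarrow> bool" where
  "composable \<Phi> \<Psi> \<longleftrightarrow>
     rhs \<Phi> = lhs \<Psi> \<and> (\<forall>y \<in> set (rhs \<Phi>). lab \<Phi> y = lab \<Psi> y) \<and>
     verts \<Phi> \<inter> verts \<Psi> = set (rhs \<Phi>)"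

definition amalg_verts :: "'v graph \<Rightarrow> 'v graph \<Rightarrow> 'v set" where
  "amalg_verts \<Phi> \<Psi> = verts \<Phi> \<union> verts \<Psi>"

text \<open>The disjoint union of the edge sets: \<open>Inl e\<close> is \<open>e\<close> as an edge of \<open>\<Phi>\<close>, \<open>Inr e\<close> is \<open>e\<close> as an edge
  of \<open>\<Psi>\<close>.\<close>

definition amalg_edges :: "'v graph \<Rightarrow> 'v graph \<Rightarrow> ('v set + 'v set) set" where
  "amalg_edges \<Phi> \<Psi> = edges \<Phi> <+> edges \<Psi>"

definition ends :: "'v set + 'v set \<Rightarrow> 'v set" where
  "ends = case_sum (\<lambda>e. e) (\<lambda>e. e)"

definition amalg_components :: "'v graph \<Rightarrow> 'v graph \<Rightarrow> 'v set set" where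
  "amalg_components \<Phi> \<Psi> = components (amalg_verts \<Phi> \<Psi>) (ends ` amalg_edges \<Phi> \<Psi>)"

text \<open>The composition \<open>\<Psi>\<Phi>\<close> of composable graphs whose amalgamation has one component. To have a new
  vertex \<open>g\<close> at hand, it lives on \<open>'v option\<close>: the places are \<open>Some x\<^sub>i\<close>, \<open>Some z\<^sub>j\<close>, and \<open>g\<close> is \<open>None\<close>.\<close>

definition star_shaped :: "'v graph \<Rightarrow> 'v graph \<Rightarrow> bool" where
  "star_shaped \<Phi> \<Psi> \<longleftrightarrow>
     (\<exists>s. (\<forall>x \<in> set (lhs \<Phi>). lab \<Phi> x = s) \<and> (\<forall>z \<in> set (rhs \<Psi>). lab \<Psi> z = - s))"

definition composition :: "'v graph \<Rightarrow> 'v graph \<Rightarrow> 'v option graph" where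
  "composition \<Psi> \<Phi> = \<lparr>
     lhs = map Some (lhs \<Phi>),
     rhs = map Some (rhs \<Psi>),
     inner = (if star_shaped \<Phi> \<Psi> then {None} else {}),
     lab = case_option 1 (\<lambda>v. if v \<in> set (lhs \<Phi>) then lab \<Phi> v else lab \<Psi> v),
     edges =
       (if star_shaped \<Phi> \<Psi> then {{Some u, None} | u. u \<in> set (lhs \<Phi>) \<union> set (rhs \<Psi>)}
        else
          {{Some u, Some v} | u v. u \<in> set (lhs \<Phi>) \<and> v \<in> set (lhs \<Phi>) \<and> lab \<Phi> u = - lab \<Phi> v} \<union>
          {{Some u, Some v} | u v. u \<in> set (rhs \<Psi>) \<and> v \<in> set (rhs \<Psi>) \<and> lab \<Psi> u = - lab \<Psi> v} \<union>
          {{Some u, Some v} | u v. u \<in> set (lhs \<Phi>) \<and> v \<in> set (rhs \<Psi>) \<and> lab \<Phi> u = lab \<Psi> v}),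
     ncomp = 1,
     cidx = (\<lambda>_. 0)\<rparr>"

text \<open>\<open>\<delta>\<gamma>\<close> as a family indexed by one-element lists of objects.\<close>

definition comp_family ::
  "('o, 'm) cat \<Rightarrow> 'v graph \<Rightarrow> 'v graph \<Rightarrow> ('o list \<Rightarrow> 'm) \<Rightarrow> ('o list \<Rightarrow> 'm) \<Rightarrow> ('o list \<Rightarrow> 'm)" where
  "comp_family A \<Psi> \<Phi> \<delta> \<gamma> =
     (\<lambda>As. Cmp A (\<delta> (replicate (ncomp \<Psi>) (hd As))) (\<gamma> (replicate (ncomp \<Phi>) (hd As))))"

text \<open>HOL has no quantification over types inside a formula, so the types from which the objects
  and the morphisms of the (small) categories are taken are parameters.\<close>

definition provides_g_dinaturality ::
  "'o itself \<Rightarrow> 'm itself \<Rightarrow> 'v graph \<Rightarrow> 'v graph \<Rightarrow> bool" where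
  "provides_g_dinaturality _ _ \<Phi> \<Psi> \<longleftrightarrow>
     (\<forall>(A :: ('o, 'm) cat) F G H \<gamma> \<delta>.
        is_category A \<longrightarrow>
        is_functor (places_cat A (lab \<Phi>) (lhs \<Phi>)) A F \<longrightarrow>
        is_functor (places_cat A (lab \<Phi>) (rhs \<Phi>)) A G \<longrightarrow>
        is_functor (places_cat A (lab \<Psi>) (rhs \<Psi>)) A H \<longrightarrow>
        g_dinatural A \<Phi> F G \<gamma> \<longrightarrow>
        g_dinatural A \<Psi> G H \<delta> \<longrightarrow>
        g_dinatural A (composition \<Psi> \<Phi>) F H (comp_family A \<Psi> \<Phi> \<delta> \<gamma>))"

definition alternating_chain ::
  "'v graph \<Rightarrow> 'v graph \<Rightarrow> 'v list \<Rightarrow> ('v set + 'v set) list \<Rightarrow> bool" where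
  "alternating_chain \<Phi> \<Psi> vs es \<longleftrightarrow>
     es \<noteq> [] \<and> length vs = Suc (length es) \<and>
     set vs \<subseteq> amalg_verts \<Phi> \<Psi> \<and> set es \<subseteq> amalg_edges \<Phi> \<Psi> \<and>
     (\<forall>i < length es. ends (es ! i) = {vs ! i, vs ! Suc i}) \<and>
     (\<forall>i. Suc i < length es \<longrightarrow> isl (es ! i) \<noteq> isl (es ! Suc i))"

definition alternating_loop ::
  "'v graph \<Rightarrow> 'v graph \<Rightarrow> 'v list \<Rightarrow> ('v set + 'v set) list \<Rightarrow> bool" where
  "alternating_loop \<Phi> \<Psi> vs es \<longleftrightarrow> alternating_chain \<Phi> \<Psi> vs es \<and> hd vs = last vs"

end

theory Submission
  imports Defs "HOL-Library.Countable"
begin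

text \<open>
  Let \<open>f : A \<rightarrow> C\<close> be a morphism. The two sides of the g-dinaturality equation of \<open>\<delta>\<gamma>\<close> differ in that all
  components of \<open>\<Phi>\<close> and \<open>\<Psi>\<close> are at \<open>C\<close> in one of them and at \<open>A\<close> in the other. The
  g-dinaturality of \<open>\<gamma>\<close> and \<open>\<delta>\<close> allows to move a single component from \<open>C\<close> to \<open>A\<close>, provided that a
  copy of \<open>f\<close> is available at each place where the component needs one (\<open>slide_component\<close>). A
  component receives its copies at middle places from components that have moved earlier. So each middle place is an
  arrow between a component of \<open>\<Phi>\<close> and a component of \<open>\<Psi>\<close>, directed by its sign, and the components
  have to move in an order that respects these arrows. A directed cycle of arrows is the same as an
  alternating loop (\<open>loop_of_cycle\<close>, \<open>cycle_of_loop\<close>): in each of the graphs, two middle places are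
  joined by an edge if and only if they have opposite signs and share a component, that is, if one
  arrow enters the component and the other one leaves it.

  If there is no cycle, then at each stage some component can be moved (\<open>movable_component\<close>), and
  finitely many moves give the equation (\<open>composite_g_dinatural_if_acyclic\<close>).

  If there is a cycle, consider the ordered set of integers as a category, with an additional
  endomorphism of \<open>0\<close>. Let the outer functors be constant with value \<open>0\<close>, and let the middle functor
  count the positive arguments along the cycle, with the signs of their places. At a tuple that is constant
  on the components of \<open>\<Phi>\<close>, or on those of \<open>\<Psi>\<close>, this count is \<open>0\<close>, since the places on the cycle
  pair off in components. So \<open>\<gamma>\<close> may be the identity of \<open>0\<close> throughout, while \<open>\<delta>\<close> may be the identity or the
  additional endomorphism according to the sign of the object in one component of \<open>\<Psi>\<close> on the cycle: when that sign
  changes along a morphism, the source of both sides of the g-dinaturality equation of \<open>\<delta>\<close> is negative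
  (\<open>height_negative\<close>), and there the two endomorphisms become indistinguishable. But \<open>\<delta>\<gamma>\<close> is not
  g-dinatural, because it takes both values (\<open>composite_not_dinatural\<close>).
\<close>

section \<open>Edges and components of a graph\<close>

lemma component_in_range:
  assumes "is_graph \<Gamma>" "u \<in> verts \<Gamma>"
  shows "cidx \<Gamma> u < ncomp \<Gamma>"
proof -
  have "cidx \<Gamma> ` verts \<Gamma> = {..<ncomp \<Gamma>}"
    using assms(1) unfolding is_graph_def by blast
  then show ?thesis using assms(2) by blast
qed

lemma place_component_in_range:
  assumes "is_graph \<Gamma>" "u \<in> set (lhs \<Gamma>) \<or> u \<in> set (rhs \<Gamma>)"
  shows "cidx \<Gamma> u < ncomp \<Gamma>"
  using assms by (intro component_in_range) (auto simp: verts_def args_def)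

lemma same_component_iff_linked:
  assumes "is_graph \<Gamma>" "u \<in> verts \<Gamma>" "v \<in> verts \<Gamma>"
  shows "cidx \<Gamma> u = cidx \<Gamma> v \<longleftrightarrow> (u, v) \<in> linked (verts \<Gamma>) (edges \<Gamma>)"
  using assms unfolding is_graph_def by blast

lemma edge_joins_distinct_vertices:
  assumes "is_graph \<Gamma>" "{u, v} \<in> edges \<Gamma>"
  shows "u \<in> verts \<Gamma>" "v \<in> verts \<Gamma>" "u \<noteq> v"
proof -
  have "\<exists>a \<in> verts \<Gamma>. \<exists>b \<in> verts \<Gamma>. a \<noteq> b \<and> {u, v} = {a, b}"
    using assms unfolding is_graph_def by blast
  then show "u \<in> verts \<Gamma>" "v \<in> verts \<Gamma>" "u \<noteq> v"
    by (auto simp: doubleton_eq_iff)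
qed

lemma edge_within_component:
  assumes "is_graph \<Gamma>" "{u, v} \<in> edges \<Gamma>"
  shows "cidx \<Gamma> u = cidx \<Gamma> v"
proof -
  have "(u, v) \<in> linked (verts \<Gamma>) (edges \<Gamma>)"
    using edge_joins_distinct_vertices[OF assms] assms(2)
    by (auto simp: linked_def intro!: r_into_rtrancl)
  then show ?thesis
    using same_component_iff_linked[OF assms(1)] edge_joins_distinct_vertices[OF assms] by blast
qed

text \<open>The edge conditions for two left-hand places and for two right-hand places coincide, so the shared
  places of two composable graphs obey the same rule in both graphs.\<close>

lemma edge_on_one_side_iff:
  assumes "is_graph \<Gamma>"
    and "u \<in> set (lhs \<Gamma>) \<and> v \<in> set (lhs \<Gamma>) \<or> u \<in> set (rhs \<Gamma>) \<and> v \<in> set (rhs \<Gamma>)"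
  shows "{u, v} \<in> edges \<Gamma> \<longleftrightarrow> lab \<Gamma> u = - lab \<Gamma> v \<and> cidx \<Gamma> u = cidx \<Gamma> v"
proof -
  have "u \<in> verts \<Gamma>" "v \<in> verts \<Gamma>"
    using assms(2) by (auto simp: verts_def args_def)
  then have link: "cidx \<Gamma> u = cidx \<Gamma> v \<longleftrightarrow> (u, v) \<in> linked (verts \<Gamma>) (edges \<Gamma>)"
    by (rule same_component_iff_linked[OF assms(1)])
  show ?thesis
    using assms unfolding is_graph_def link by blast
qed

lemma place_sign:
  assumes "is_graph \<Gamma>" "u \<in> set (lhs \<Gamma>) \<or> u \<in> set (rhs \<Gamma>)"
  shows "lab \<Gamma> u = 1 \<or> lab \<Gamma> u = - 1"
  using assms unfolding is_graph_def args_def by blast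

section \<open>The order in which components have to be moved\<close>

text \<open>To pass from the target \<open>C\<close> of a morphism \<open>f\<close> to its source \<open>A\<close>, one component after the other of the
  amalgamation is moved from \<open>C\<close> to \<open>A\<close>. Moving a component uses up a copy of \<open>f\<close> at each of its positive
  left-hand and negative right-hand places, and leaves one at the other places. Hence at a positive
  middle place the component of \<open>\<Phi>\<close> has to move before that of \<open>\<Psi>\<close>, and at a negative one it
  is the other way round: every middle place is an arrow between components. The relation below
  says that the arrow \<open>v\<close> starts in the component in which the arrow \<open>u\<close> ends.\<close>

definition precedes :: "'v graph \<Rightarrow> 'v graph \<Rightarrow> ('v \<times> 'v) set" where
  "precedes \<Phi> \<Psi> = {(u, v). u \<in> set (rhs \<Phi>) \<and> v \<in> set (rhs \<Phi>) \<and>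
     (lab \<Phi> u = - 1 \<and> lab \<Phi> v = 1 \<and> cidx \<Phi> u = cidx \<Phi> v \<or>
      lab \<Phi> u = 1 \<and> lab \<Phi> v = - 1 \<and> cidx \<Psi> u = cidx \<Psi> v)}"

lemma cycle_of_not_acyclic:
  assumes "\<not> acyclic R"
  obtains n and y :: "nat \<Rightarrow> 'a"
    where "0 < n" "y n = y 0" "\<And>i. i < n \<Longrightarrow> (y i, y (Suc i)) \<in> R"
proof -
  obtain a where "(a, a) \<in> R\<^sup>+"
    using assms by (auto simp: acyclic_def)
  then obtain n where "0 < n" "(a, a) \<in> R ^^ n"
    by (auto simp: trancl_power)
  then show thesis
    by (auto simp: relpow_fun_conv intro: that)
qed

locale composable_graphs =
  fixes \<Phi> \<Psi> :: "'v graph"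
  assumes \<Phi>: "is_graph \<Phi>" and \<Psi>: "is_graph \<Psi>" and comp: "composable \<Phi> \<Psi>"
begin

abbreviation Y where "Y \<equiv> set (rhs \<Phi>)"

abbreviation R where "R \<equiv> precedes \<Phi> \<Psi>"

abbreviation composite where "composite \<equiv> composition \<Psi> \<Phi>"

lemma middle: "lhs \<Psi> = rhs \<Phi>"
  using comp by (simp add: composable_def)

lemma middle_sign: "y \<in> Y \<Longrightarrow> lab \<Psi> y = lab \<Phi> y"
  using comp by (simp add: composable_def)

lemma sign: "y \<in> Y \<Longrightarrow> lab \<Phi> y = 1 \<or> lab \<Phi> y = - 1"
  using place_sign[OF \<Phi>] by blast

lemma shared_vertex: "v \<in> verts \<Phi> \<Longrightarrow> v \<in> verts \<Psi> \<Longrightarrow> v \<in> Y"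
  using comp by (auto simp: composable_def)

lemma edge_\<Phi>_iff:
  "u \<in> Y \<Longrightarrow> v \<in> Y \<Longrightarrow> {u, v} \<in> edges \<Phi> \<longleftrightarrow> lab \<Phi> u = - lab \<Phi> v \<and> cidx \<Phi> u = cidx \<Phi> v"
  using edge_on_one_side_iff[OF \<Phi>] by blast

lemma edge_\<Psi>_iff:
  "u \<in> Y \<Longrightarrow> v \<in> Y \<Longrightarrow> {u, v} \<in> edges \<Psi> \<longleftrightarrow> lab \<Phi> u = - lab \<Phi> v \<and> cidx \<Psi> u = cidx \<Psi> v"
  using edge_on_one_side_iff[OF \<Psi>] middle_sign by (simp add: middle)

text \<open>Related places have opposite signs and share a component, so they are joined by an edge of the
  graph concerned; the alternation of signs is the alternation of the two graphs.\<close>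

lemma loop_of_cycle:
  assumes "\<not> acyclic R"
  shows "\<exists>vs es. alternating_loop \<Phi> \<Psi> vs es"
proof -
  obtain n y where n: "0 < n" "y n = y 0" and step: "\<And>i. i < n \<Longrightarrow> (y i, y (Suc i)) \<in> R"
    using cycle_of_not_acyclic[OF assms] by blast
  define e where "e i = (if lab \<Phi> (y i) = - 1 then Inl else Inr) {y i, y (Suc i)}" for i
  define vs where "vs = map y [0..<Suc n]"
  define es where "es = map e [0..<n]"
  have Y: "y i \<in> Y" if "i \<le> n" for i
    using step[of i] step[of 0] n that by (cases "i = n") (auto simp: precedes_def)
  have e: "e i \<in> amalg_edges \<Phi> \<Psi>" if "i < n" for i
    using step[OF that] edge_\<Phi>_iff edge_\<Psi>_iff
    by (auto simp: precedes_def e_def amalg_edges_def)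
  have "set vs \<subseteq> amalg_verts \<Phi> \<Psi>"
    using Y by (auto simp: vs_def amalg_verts_def verts_def args_def)
  moreover have "ends (e i) = {y i, y (Suc i)}" for i
    by (simp add: ends_def e_def)
  moreover have "isl (e i) \<noteq> isl (e (Suc i))" if "Suc i < n" for i
    using step[of i] step[of "Suc i"] that by (auto simp: precedes_def e_def)
  moreover have "hd vs = last vs"
    using n by (simp add: vs_def hd_map last_map del: upt_Suc)
  ultimately have "alternating_loop \<Phi> \<Psi> vs es"
    using n e by (auto simp: alternating_loop_def alternating_chain_def vs_def es_def
        simp del: upt_Suc)
  then show ?thesis by blast
qed

text \<open>An interior vertex of an alternating chain lies on edges of both graphs, so it is a middle place,
  and along middle places an alternating chain follows the relation in one fixed direction. The only
  delicate point is the vertex at which the loop closes. If the first and the last edge come from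
  different graphs, it is a middle place as well. If they come from the same graph, skip it: its two
  neighbours lie in one component of that graph, and being joined by a chain of odd length they have
  opposite signs.\<close>

lemma cycle_of_loop:
  assumes "alternating_loop \<Phi> \<Psi> vs es"
  shows "\<not> acyclic R"
proof
  assume acyc: "acyclic R"
  define n where "n = length es"
  define inP where "inP i = isl (es ! i)" for i
  define v where "v i = vs ! i" for i
  \<comment> \<open>The direction of the chain at its \<open>i\<close>-th vertex.\<close>
  define fwd where "fwd i \<longleftrightarrow> (inP i \<longleftrightarrow> lab \<Phi> (v i) = - 1)" for i
  have n: "0 < n" and len: "length vs = Suc n" and "vs \<noteq> []"
    using assms by (auto simp: alternating_loop_def alternating_chain_def n_def)
  have closed: "v n = v 0"
    using assms len \<open>vs \<noteq> []\<close>
    by (simp add: alternating_loop_def v_def hd_conv_nth last_conv_nth)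
  have edge: "{v i, v (Suc i)} \<in> edges (if inP i then \<Phi> else \<Psi>)" if "i < n" for i
  proof -
    have "es ! i \<in> amalg_edges \<Phi> \<Psi>" "ends (es ! i) = {v i, v (Suc i)}"
      using assms that nth_mem[of i es]
      by (auto simp: alternating_loop_def alternating_chain_def n_def v_def)
    then show ?thesis
      by (auto simp: amalg_edges_def ends_def inP_def)
  qed
  have alt: "inP i \<noteq> inP (Suc i)" if "Suc i < n" for i
    using assms that by (auto simp: alternating_loop_def alternating_chain_def n_def inP_def)
  have ends: "v i \<in> verts (if inP i then \<Phi> else \<Psi>)"
    "v (Suc i) \<in> verts (if inP i then \<Phi> else \<Psi>)"
    "v i \<noteq> v (Suc i)"
    "cidx (if inP i then \<Phi> else \<Psi>) (v i) = cidx (if inP i then \<Phi> else \<Psi>) (v (Suc i))"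
    if "i < n" for i
  proof -
    have g: "is_graph (if inP i then \<Phi> else \<Psi>)" using \<Phi> \<Psi> by simp
    show "v i \<in> verts (if inP i then \<Phi> else \<Psi>)"
      "v (Suc i) \<in> verts (if inP i then \<Phi> else \<Psi>)"
      "v i \<noteq> v (Suc i)"
      "cidx (if inP i then \<Phi> else \<Psi>) (v i) = cidx (if inP i then \<Phi> else \<Psi>) (v (Suc i))"
      by (fact edge_joins_distinct_vertices[OF g edge[OF that]]
          edge_within_component[OF g edge[OF that]])+
  qed
  have inner_Y: "v i \<in> Y" if "0 < i" "i < n" for i
  proof (cases i)
    case 0
    then show ?thesis using that by simp
  next
    case (Suc j)
    then show ?thesis
      using ends(2)[of j] ends(1)[of i] alt[of j] that
      by (cases "inP i") (simp_all add: shared_vertex)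
  qed
  have step: "(v i, v (Suc i)) \<in> (if fwd i then R else R\<inverse>)"
    "lab \<Phi> (v (Suc i)) = - lab \<Phi> (v i)"
    if "i < n" "v i \<in> Y" "v (Suc i) \<in> Y" for i
    using edge[OF that(1)] edge_\<Phi>_iff[OF that(2,3)] edge_\<Psi>_iff[OF that(2,3)]
      sign[OF that(2)] sign[OF that(3)] that(2,3)
    by (cases "inP i"; auto simp: fwd_def precedes_def)+
  have fwd_Suc: "fwd (Suc i) = fwd i" if "Suc i < n" "v i \<in> Y" "v (Suc i) \<in> Y" for i
    using step(2)[of i] alt[of i] that sign[OF that(2)] by (auto simp: fwd_def)
  have path: "(v a, v (a + d)) \<in> (if fwd a then R else R\<inverse>)\<^sup>* \<and>
      (0 < d \<longrightarrow> (v a, v (a + d)) \<in> (if fwd a then R else R\<inverse>)\<^sup>+) \<and>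
      (a + d < n \<longrightarrow> fwd (a + d) = fwd a)"
    if "a + d \<le> n" "\<And>i. a \<le> i \<Longrightarrow> i \<le> a + d \<Longrightarrow> v i \<in> Y" for a d
    using that
  proof (induction d)
    case 0
    then show ?case by simp
  next
    case (Suc d)
    then have IH: "(v a, v (a + d)) \<in> (if fwd a then R else R\<inverse>)\<^sup>*" "fwd (a + d) = fwd a"
      by auto
    have "v (a + d) \<in> Y" "v (Suc (a + d)) \<in> Y" using Suc.prems by auto
    then have "(v (a + d), v (Suc (a + d))) \<in> (if fwd a then R else R\<inverse>)"
      and "a + Suc d < n \<longrightarrow> fwd (a + Suc d) = fwd a"
      using step(1)[of "a + d"] fwd_Suc[of "a + d"] IH(2) Suc.prems(1) by auto
    then show ?case
      using IH(1) by (simp del: trancl_converse rtrancl_converse split del: if_split)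
        (blast intro: rtrancl_into_trancl1 rtrancl_into_rtrancl)
  qed
  have acyc': "(u, u) \<notin> (if b then R else R\<inverse>)\<^sup>+" for u b
    using acyc acyclic_converse[of R] by (auto simp: acyclic_def trancl_converse)
  show False
  proof (cases "inP 0 = inP (n - 1)")
    case False
    have "v 0 \<in> Y"
      using ends(1)[of 0] ends(2)[of "n - 1"] n closed False
      by (cases "inP 0") (simp_all add: shared_vertex)
    then have "v i \<in> Y" if "i \<le> n" for i
      using inner_Y[of i] that closed by (cases "i = 0 \<or> i = n") auto
    then show False
      using path[of 0 n] n closed acyc'[of "v 0" "fwd 0"] by auto
  next
    case True
    have "n \<noteq> 1"
      using ends(3)[of 0] closed by auto
    moreover have "n \<noteq> 2"
      using alt[of 0] True by auto
    ultimately have n3: "3 \<le> n" using n by simp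
    have Suc1: "Suc (n - 1) = n" "1 + (n - 2) = n - 1" using n3 by auto
    have p: "(v 1, v (n - 1)) \<in> (if fwd 1 then R else R\<inverse>)\<^sup>+" "fwd (n - 1) = fwd 1"
      using path[of 1 "n - 2"] inner_Y n3 unfolding Suc1 by auto
    have comp: "cidx (if inP 0 then \<Phi> else \<Psi>) (v (n - 1)) = cidx (if inP 0 then \<Phi> else \<Psi>) (v 1)"
      using ends(4)[of 0] ends(4)[of "n - 1"] closed n True Suc1(1) by simp
    have "inP 1 \<noteq> inP 0" using alt[of 0] n3 by simp
    then have "(v (n - 1), v 1) \<in> (if fwd 1 then R else R\<inverse>)"
      using p(2) comp True inner_Y[of 1] inner_Y[of "n - 1"] sign[of "v 1"] sign[of "v (n - 1)"] n3
      by (auto simp: fwd_def precedes_def split: if_splits)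
    then show False
      using trancl_into_trancl[OF p(1)] acyc'[of "v 1" "fwd 1"] by blast
  qed
qed

end

section \<open>Categories, products and functors\<close>

locale category =
  fixes A :: "('o, 'm) cat"
  assumes cat: "is_category A"
begin

lemma cat_dom: "f \<in> Mor A \<Longrightarrow> Dom A f \<in> Ob A"
  and cat_cod: "f \<in> Mor A \<Longrightarrow> Cod A f \<in> Ob A"
  and cat_id: "X \<in> Ob A \<Longrightarrow> Idm A X \<in> Hom A X X"
  using cat unfolding is_category_def by blast+

lemma cat_comp: "f \<in> Hom A X Y \<Longrightarrow> g \<in> Hom A Y Z \<Longrightarrow> Cmp A g f \<in> Hom A X Z"
  using cat unfolding is_category_def Hom_def by auto

lemma cat_comp_id_right: "f \<in> Hom A X Y \<Longrightarrow> Cmp A f (Idm A X) = f"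
  and cat_comp_id_left: "f \<in> Hom A X Y \<Longrightarrow> Cmp A (Idm A Y) f = f"
  using cat unfolding is_category_def Hom_def by auto

lemma cat_assoc:
  assumes "f \<in> Hom A X Y" "g \<in> Hom A Y Z" "h \<in> Hom A Z W"
  shows "Cmp A h (Cmp A g f) = Cmp A (Cmp A h g) f"
  using cat assms unfolding is_category_def Hom_def by auto

end

lemma Hom_iff: "f \<in> Hom A X Y \<longleftrightarrow> f \<in> Mor A \<and> Dom A f = X \<and> Cod A f = Y"
  by (simp add: Hom_def)

lemma Ob_places_iff:
  "map \<phi> us \<in> Ob (places_cat A l us) \<longleftrightarrow> (\<forall>u \<in> set us. \<phi> u \<in> Ob A)"
  by (auto simp: places_cat_def prod_cat_def signed_cat_def op_cat_def all_set_conv_all_nth)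

lemma Mor_places_iff:
  "map w us \<in> Mor (places_cat A l us) \<longleftrightarrow> (\<forall>u \<in> set us. w u \<in> Mor A)"
  by (auto simp: places_cat_def prod_cat_def signed_cat_def op_cat_def all_set_conv_all_nth)

lemma map2_map_same: "map2 h (map f us) (map g us) = map (\<lambda>u. h (f u) (g u)) us"
  by (induction us) auto

lemma Dom_places:
  "Dom (places_cat A l us) (map w us) =
     map (\<lambda>u. if l u = 1 then Dom A (w u) else Cod A (w u)) us"
  by (simp add: places_cat_def prod_cat_def map2_map_same signed_cat_def op_cat_def)

lemma Cod_places:
  "Cod (places_cat A l us) (map w us) =
     map (\<lambda>u. if l u = 1 then Cod A (w u) else Dom A (w u)) us"
  by (simp add: places_cat_def prod_cat_def map2_map_same signed_cat_def op_cat_def)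

lemma Idm_places:
  "Idm (places_cat A l us) (map \<phi> us) = map (\<lambda>u. Idm A (\<phi> u)) us"
  by (simp add: places_cat_def prod_cat_def map2_map_same signed_cat_def op_cat_def)

lemma Cmp_places:
  "Cmp (places_cat A l us) (map w' us) (map w us) =
     map (\<lambda>u. if l u = 1 then Cmp A (w' u) (w u) else Cmp A (w u) (w' u)) us"
proof -
  have "zip (map w' us) (map w us) = map (\<lambda>u. (w' u, w u)) us"
    by (induction us) auto
  then show ?thesis
    by (simp add: places_cat_def prod_cat_def map2_map_same signed_cat_def op_cat_def)
qed

section \<open>Places between the source and the target of an arrow\<close>

text \<open>Everything in a single g-dinaturality equation happens over one morphism \<open>f\<close>, that is, over a
  functor from the ordinal \<open>False < True\<close> that sends the only step to \<open>f\<close>. So a tuple of objects is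
  encoded by a truth value at each place (\<open>True\<close> for the target of \<open>f\<close>), and a tuple of morphisms by
  two such assignments of which the first is below the second; at negative places the order is
  reversed. In this encoding composing tuples of morphisms is transitivity.\<close>

locale arrow = category A for A :: "('o, 'm) cat" +
  fixes f :: 'm
  assumes f: "f \<in> Mor A"
begin

definition ob :: "bool \<Rightarrow> 'o" where
  "ob x = (if x then Cod A f else Dom A f)"

text \<open>The morphism from \<open>ob x\<close> to \<open>ob y\<close>; meant for \<open>x \<le> y\<close>.\<close>

definition ar :: "bool \<Rightarrow> bool \<Rightarrow> 'm" where
  "ar x y = (if x = y then Idm A (ob x) else f)"

definition signed_le :: "('v \<Rightarrow> int) \<Rightarrow> ('v \<Rightarrow> bool) \<Rightarrow> ('v \<Rightarrow> bool) \<Rightarrow> 'v \<Rightarrow> bool" where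
  "signed_le l b b' u \<longleftrightarrow> (if l u = 1 then b u \<le> b' u else b' u \<le> b u)"

definition obj_at where
  "obj_at T us b = omap T (map (\<lambda>u. ob (b u)) us)"

definition signed_ar :: "('v \<Rightarrow> int) \<Rightarrow> ('v \<Rightarrow> bool) \<Rightarrow> ('v \<Rightarrow> bool) \<Rightarrow> 'v \<Rightarrow> 'm" where
  "signed_ar l b b' u = (if l u = 1 then ar (b u) (b' u) else ar (b' u) (b u))"

definition mor_at where
  "mor_at T l us b b' = mmap T (map (signed_ar l b b') us)"

lemma ob_in: "ob x \<in> Ob A"
  using f cat_dom cat_cod by (simp add: ob_def)

lemma ar_hom: "x \<le> y \<Longrightarrow> ar x y \<in> Hom A (ob x) (ob y)"
  using f cat_id[OF ob_in] by (auto simp: ar_def ob_def Hom_iff)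

lemma ar_comp: "x \<le> y \<Longrightarrow> y \<le> z \<Longrightarrow> Cmp A (ar y z) (ar x y) = ar x z"
  using ar_hom[of x y] ar_hom[of y z] cat_comp_id_left[of "ar x y"] cat_comp_id_right[of "ar y z"]
  by (cases x; cases y; cases z) (auto simp: ar_def)

lemma signed_ar_in: "signed_le l b b' u \<Longrightarrow> signed_ar l b b' u \<in> Mor A"
  and signed_ar_source: "signed_le l b b' u \<Longrightarrow>
    (if l u = 1 then Dom A (signed_ar l b b' u) else Cod A (signed_ar l b b' u)) = ob (b u)"
  and signed_ar_target: "signed_le l b b' u \<Longrightarrow>
    (if l u = 1 then Cod A (signed_ar l b b' u) else Dom A (signed_ar l b b' u)) = ob (b' u)"
  using ar_hom[of "b u" "b' u"] ar_hom[of "b' u" "b u"]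
  by (auto simp: signed_le_def signed_ar_def Hom_iff)

lemma signed_ar_comp:
  "signed_le l b b' u \<Longrightarrow> signed_le l b' b'' u \<Longrightarrow>
    (if l u = 1 then Cmp A (signed_ar l b' b'' u) (signed_ar l b b' u)
     else Cmp A (signed_ar l b b' u) (signed_ar l b' b'' u)) = signed_ar l b b'' u"
  by (auto simp: signed_le_def signed_ar_def ar_comp split: if_splits)

lemma mor_at_cong:
  assumes "\<And>u. u \<in> set us \<Longrightarrow> l u = l' u" "\<And>u. u \<in> set us \<Longrightarrow> b u = c u"
    "\<And>u. u \<in> set us \<Longrightarrow> b' u = c' u"
  shows "mor_at T l us b b' = mor_at T l' us c c'"
  unfolding mor_at_def using assms
  by (intro arg_cong[where f = "mmap T"]) (simp add: signed_ar_def)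

lemma obj_at_cong:
  assumes "\<And>u. u \<in> set us \<Longrightarrow> b u = c u"
  shows "obj_at T us b = obj_at T us c"
  unfolding obj_at_def using assms by (intro arg_cong[where f = "omap T"]) simp

context
  fixes T :: "('o list, 'm list, 'o, 'm) functr" and l :: "'v \<Rightarrow> int" and us :: "'v list"
  assumes T: "is_functor (places_cat A l us) A T"
begin

lemma mor_at_hom:
  assumes "\<And>u. u \<in> set us \<Longrightarrow> signed_le l b b' u"
  shows "mor_at T l us b b' \<in> Hom A (obj_at T us b) (obj_at T us b')"
proof -
  have "map (signed_ar l b b') us \<in> Mor (places_cat A l us)"
    by (simp_all add: Mor_places_iff signed_ar_in assms)
  moreover have "Dom (places_cat A l us) (map (signed_ar l b b') us) = map (\<lambda>u. ob (b u)) us"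
    by (simp add: Dom_places signed_ar_source assms cong: map_cong)
  moreover have "Cod (places_cat A l us) (map (signed_ar l b b') us) = map (\<lambda>u. ob (b' u)) us"
    by (simp add: Cod_places signed_ar_target assms cong: map_cong)
  ultimately show ?thesis
    using T unfolding is_functor_def mor_at_def obj_at_def by metis
qed

lemma mor_at_comp:
  assumes "\<And>u. u \<in> set us \<Longrightarrow> signed_le l b b' u"
    and "\<And>u. u \<in> set us \<Longrightarrow> signed_le l b' b'' u"
  shows "mor_at T l us b b'' = Cmp A (mor_at T l us b' b'') (mor_at T l us b b')"
proof -
  let ?w = "map (signed_ar l b b') us" and ?w' = "map (signed_ar l b' b'') us"
  have "?w \<in> Mor (places_cat A l us)" "?w' \<in> Mor (places_cat A l us)"
    by (simp_all add: Mor_places_iff signed_ar_in assms)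
  moreover have "Cod (places_cat A l us) ?w = Dom (places_cat A l us) ?w'"
    by (simp add: Cod_places Dom_places signed_ar_source signed_ar_target assms cong: map_cong)
  ultimately have "mmap T (Cmp (places_cat A l us) ?w' ?w) = Cmp A (mmap T ?w') (mmap T ?w)"
    using T by (auto simp: is_functor_def)
  moreover have "Cmp (places_cat A l us) ?w' ?w = map (signed_ar l b b'') us"
    by (simp add: Cmp_places signed_ar_comp assms cong: map_cong)
  ultimately show ?thesis
    by (simp add: mor_at_def)
qed

lemma mor_at_same: "mor_at T l us b b = Idm A (obj_at T us b)"
proof -
  have "mmap T (Idm (places_cat A l us) (map (\<lambda>u. ob (b u)) us)) = Idm A (obj_at T us b)"
    using T Ob_places_iff[of "\<lambda>u. ob (b u)" us A l] ob_in
    by (auto simp: is_functor_def obj_at_def)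
  then show ?thesis
    by (simp add: mor_at_def Idm_places signed_ar_def ar_def cong: map_cong)
qed

end

definition stage :: "nat \<Rightarrow> (nat \<Rightarrow> bool) \<Rightarrow> 'o list" where
  "stage k p = map (\<lambda>i. ob (p i)) [0..<k]"

lemma set_stage: "set (stage k p) \<subseteq> Ob A"
  using ob_in by (auto simp: stage_def)

lemma stage_update: "i < k \<Longrightarrow> (stage k p)[i := ob x] = stage k (p(i := x))"
  by (rule nth_equalityI) (auto simp: stage_def nth_list_update)

lemma objs_stage:
  assumes "\<And>u. u \<in> set us \<Longrightarrow> cidx \<Gamma> u < ncomp \<Gamma>"
  shows "omap T (objs \<Gamma> (stage (ncomp \<Gamma>) p) us) = obj_at T us (\<lambda>u. p (cidx \<Gamma> u))"
proof -
  have "objs \<Gamma> (stage (ncomp \<Gamma>) p) us = map (\<lambda>u. ob (p (cidx \<Gamma> u))) us"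
    using assms by (auto simp: objs_def stage_def)
  then show ?thesis by (simp add: obj_at_def)
qed

lemma family_hom:
  assumes "is_graph \<Gamma>" "g_dinatural A \<Gamma> T S \<alpha>"
  shows "\<alpha> (stage (ncomp \<Gamma>) p) \<in>
    Hom A (obj_at T (lhs \<Gamma>) (\<lambda>u. p (cidx \<Gamma> u))) (obj_at S (rhs \<Gamma>) (\<lambda>u. p (cidx \<Gamma> u)))"
proof -
  have "length (stage (ncomp \<Gamma>) p) = ncomp \<Gamma>"
    by (simp add: stage_def)
  then have "\<alpha> (stage (ncomp \<Gamma>) p) \<in> Hom A (omap T (objs \<Gamma> (stage (ncomp \<Gamma>) p) (lhs \<Gamma>)))
      (omap S (objs \<Gamma> (stage (ncomp \<Gamma>) p) (rhs \<Gamma>)))"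
    using assms(2) set_stage by (auto simp: g_dinatural_def)
  moreover have "omap T (objs \<Gamma> (stage (ncomp \<Gamma>) p) (lhs \<Gamma>)) =
      obj_at T (lhs \<Gamma>) (\<lambda>u. p (cidx \<Gamma> u))"
    by (rule objs_stage) (simp add: place_component_in_range[OF assms(1)])
  moreover have "omap S (objs \<Gamma> (stage (ncomp \<Gamma>) p) (rhs \<Gamma>)) =
      obj_at S (rhs \<Gamma>) (\<lambda>u. p (cidx \<Gamma> u))"
    by (rule objs_stage) (simp add: place_component_in_range[OF assms(1)])
  ultimately show ?thesis by simp
qed

lemma mors_stage:
  assumes "\<And>u. u \<in> set us \<Longrightarrow> cidx \<Gamma> u < ncomp \<Gamma>"
  shows "mmap T (mors A \<Gamma> (stage (ncomp \<Gamma>) p) i (ar x y) (ar x' y') us) =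
    mor_at T (lab \<Gamma>) us
      (\<lambda>u. if cidx \<Gamma> u = i then if lab \<Gamma> u = 1 then x else y' else p (cidx \<Gamma> u))
      (\<lambda>u. if cidx \<Gamma> u = i then if lab \<Gamma> u = 1 then y else x' else p (cidx \<Gamma> u))"
  unfolding mor_at_def mors_def using assms
  by (intro arg_cong[where f = "mmap T"]) (auto simp: stage_def signed_ar_def ar_def)

text \<open>One component of one graph moves from the target to the source of \<open>f\<close>, with arbitrary compatible
  assignments before and behind. Apart from component \<open>i\<close>, the outer morphisms factor through
  \<open>m\<close> and \<open>m'\<close>, which differ from the current assignment only in component \<open>i\<close>; what remains in the
  middle is one side of the g-dinaturality equation for component \<open>i\<close>.\<close>

lemma slide_component:
  fixes b b' :: "'v \<Rightarrow> bool"
  assumes \<Gamma>: "is_graph \<Gamma>" and \<alpha>: "g_dinatural A \<Gamma> T S \<alpha>"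
    and T: "is_functor (places_cat A (lab \<Gamma>) (lhs \<Gamma>)) A T"
    and S: "is_functor (places_cat A (lab \<Gamma>) (rhs \<Gamma>)) A S"
    and i: "i < ncomp \<Gamma>"
    and lo: "\<And>u x. u \<in> set (lhs \<Gamma>) \<Longrightarrow> signed_le (lab \<Gamma>) b (\<lambda>u. (p(i := x)) (cidx \<Gamma> u)) u"
    and hi: "\<And>u x. u \<in> set (rhs \<Gamma>) \<Longrightarrow> signed_le (lab \<Gamma>) (\<lambda>u. (p(i := x)) (cidx \<Gamma> u)) b' u"
  defines "E \<equiv> \<lambda>x. Cmp A (mor_at S (lab \<Gamma>) (rhs \<Gamma>) (\<lambda>u. (p(i := x)) (cidx \<Gamma> u)) b')
      (Cmp A (\<alpha> (stage (ncomp \<Gamma>) (p(i := x))))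
        (mor_at T (lab \<Gamma>) (lhs \<Gamma>) b (\<lambda>u. (p(i := x)) (cidx \<Gamma> u))))"
  shows "E True = E False"
proof -
  let ?k = "ncomp \<Gamma>"
  define q where "q x u = (p(i := x)) (cidx \<Gamma> u)" for x u
  define m where "m u = (if cidx \<Gamma> u = i then lab \<Gamma> u \<noteq> 1 else p (cidx \<Gamma> u))" for u
  define m' where "m' u = (if cidx \<Gamma> u = i then lab \<Gamma> u = 1 else p (cidx \<Gamma> u))" for u
  let ?S = "mor_at S (lab \<Gamma>) (rhs \<Gamma>)" and ?T = "mor_at T (lab \<Gamma>) (lhs \<Gamma>)"
  have le: "signed_le (lab \<Gamma>) m (q x) u" "signed_le (lab \<Gamma>) (q x) m' u" for x u
    by (auto simp: signed_le_def q_def m_def m'_def)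
  have lo_m: "signed_le (lab \<Gamma>) b m u" if "u \<in> set (lhs \<Gamma>)" for u
    using lo[OF that, of True] lo[OF that, of False]
    by (auto simp: signed_le_def m_def split: if_splits)
  have hi_m: "signed_le (lab \<Gamma>) m' b' u" if "u \<in> set (rhs \<Gamma>)" for u
    using hi[OF that, of True] hi[OF that, of False]
    by (auto simp: signed_le_def m'_def split: if_splits)
  have range: "\<And>u. u \<in> set (lhs \<Gamma>) \<Longrightarrow> cidx \<Gamma> u < ?k" "\<And>u. u \<in> set (rhs \<Gamma>) \<Longrightarrow> cidx \<Gamma> u < ?k"
    using place_component_in_range[OF \<Gamma>] by auto
  have ids: "Idm A (Cod A f) = ar True True" "Idm A (Dom A f) = ar False False"
    "f = ar False True"
    by (simp_all add: ar_def ob_def)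
  have upd: "(stage ?k p)[i := Cod A f] = stage ?k (p(i := True))"
    "(stage ?k p)[i := Dom A f] = stage ?k (p(i := False))"
    using stage_update[OF i, of p True] stage_update[OF i, of p False] by (simp_all add: ob_def)
  have places:
    "mmap S (mors A \<Gamma> (stage ?k p) i (ar True True) (ar False True) (rhs \<Gamma>)) = ?S (q True) m'"
    "mmap S (mors A \<Gamma> (stage ?k p) i (ar False True) (ar False False) (rhs \<Gamma>)) = ?S (q False) m'"
    "mmap T (mors A \<Gamma> (stage ?k p) i (ar False True) (ar True True) (lhs \<Gamma>)) = ?T m (q True)"
    "mmap T (mors A \<Gamma> (stage ?k p) i (ar False False) (ar False True) (lhs \<Gamma>)) = ?T m (q False)"
    by (simp_all add: mors_stage range)
      (auto simp: q_def m_def m'_def fun_eq_iff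
        intro!: arg_cong2[where f = ?S] arg_cong2[where f = ?T])
  have len: "length (stage ?k p) = ?k" by (simp add: stage_def)
  have din: "Cmp A (?S (q True) m') (Cmp A (\<alpha> (stage ?k (p(i := True)))) (?T m (q True))) =
      Cmp A (?S (q False) m') (Cmp A (\<alpha> (stage ?k (p(i := False)))) (?T m (q False)))"
  proof -
    have "\<And>As. length As = ?k \<and> set As \<subseteq> Ob A \<Longrightarrow>
       Cmp A (mmap S (mors A \<Gamma> As i (Idm A (Cod A f)) f (rhs \<Gamma>)))
            (Cmp A (\<alpha> (As[i := Cod A f]))
                   (mmap T (mors A \<Gamma> As i f (Idm A (Cod A f)) (lhs \<Gamma>)))) =
          Cmp A (mmap S (mors A \<Gamma> As i f (Idm A (Dom A f)) (rhs \<Gamma>)))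
            (Cmp A (\<alpha> (As[i := Dom A f]))
                   (mmap T (mors A \<Gamma> As i (Idm A (Dom A f)) f (lhs \<Gamma>))))"
      using \<alpha> i f unfolding g_dinatural_def Let_def by blast
    from this[of "stage ?k p"] len set_stage[of ?k p]
    show ?thesis
      unfolding upd ids(1,2) unfolding places[unfolded ids(3)[symmetric]] by blast
  qed
  have split: "E x = Cmp A (?S m' b')
      (Cmp A (Cmp A (?S (q x) m') (Cmp A (\<alpha> (stage ?k (p(i := x)))) (?T m (q x)))) (?T b m))" for x
  proof -
    have S1: "?S (q x) m' \<in> Hom A (obj_at S (rhs \<Gamma>) (q x)) (obj_at S (rhs \<Gamma>) m')"
      and S2: "?S m' b' \<in> Hom A (obj_at S (rhs \<Gamma>) m') (obj_at S (rhs \<Gamma>) b')"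
      and T1: "?T b m \<in> Hom A (obj_at T (lhs \<Gamma>) b) (obj_at T (lhs \<Gamma>) m)"
      and T2: "?T m (q x) \<in> Hom A (obj_at T (lhs \<Gamma>) m) (obj_at T (lhs \<Gamma>) (q x))"
      using mor_at_hom[OF S] mor_at_hom[OF T] le lo_m hi_m by blast+
    have a: "\<alpha> (stage ?k (p(i := x))) \<in> Hom A (obj_at T (lhs \<Gamma>) (q x)) (obj_at S (rhs \<Gamma>) (q x))"
      using family_hom[OF \<Gamma> \<alpha>, of "p(i := x)"] unfolding q_def .
    have S12: "?S (q x) b' = Cmp A (?S m' b') (?S (q x) m')"
      by (rule mor_at_comp[OF S]) (use le hi_m in blast)+
    have T12: "?T b (q x) = Cmp A (?T m (q x)) (?T b m)"
      by (rule mor_at_comp[OF T]) (use le lo_m in blast)+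
    have "E x = Cmp A (Cmp A (?S m' b') (?S (q x) m'))
        (Cmp A (\<alpha> (stage ?k (p(i := x)))) (Cmp A (?T m (q x)) (?T b m)))"
      unfolding E_def S12[symmetric] T12[symmetric] unfolding q_def ..
    also have "\<dots> = Cmp A (?S m' b') (Cmp A (?S (q x) m')
        (Cmp A (\<alpha> (stage ?k (p(i := x)))) (Cmp A (?T m (q x)) (?T b m))))"
      by (rule cat_assoc[symmetric, OF cat_comp[OF cat_comp[OF T1 T2] a] S1 S2])
    also have "Cmp A (\<alpha> (stage ?k (p(i := x)))) (Cmp A (?T m (q x)) (?T b m)) =
        Cmp A (Cmp A (\<alpha> (stage ?k (p(i := x)))) (?T m (q x))) (?T b m)"
      by (rule cat_assoc[OF T1 T2 a])
    also have "Cmp A (?S (q x) m')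
        (Cmp A (Cmp A (\<alpha> (stage ?k (p(i := x)))) (?T m (q x))) (?T b m)) =
      Cmp A (Cmp A (?S (q x) m') (Cmp A (\<alpha> (stage ?k (p(i := x)))) (?T m (q x)))) (?T b m)"
      by (rule cat_assoc[OF T1 cat_comp[OF T2 a] S1])
    finally show ?thesis .
  qed
  show ?thesis
    unfolding split din ..
qed

end

section \<open>Without a cycle, the composition is g-dinatural\<close>

context composable_graphs
begin

text \<open>\<open>P\<close> and \<open>Q\<close> are the components of \<open>\<Phi>\<close> and \<open>\<Psi>\<close> that are still at the target of \<open>f\<close>. The condition
  is that the value of the middle functor is still a morphism from the position of \<open>\<Phi>\<close> to that of
  \<open>\<Psi>\<close>.\<close>

definition compatible :: "nat set \<Rightarrow> nat set \<Rightarrow> bool" where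
  "compatible P Q \<longleftrightarrow> (\<forall>y \<in> Y. if lab \<Phi> y = 1 then cidx \<Phi> y \<in> P \<longrightarrow> cidx \<Psi> y \<in> Q
     else cidx \<Psi> y \<in> Q \<longrightarrow> cidx \<Phi> y \<in> P)"

text \<open>A component that cannot move is blocked by a middle place between two unmoved components. If
  nothing can move, each such place has a predecessor of the same kind, which is impossible for an
  acyclic relation on a finite set.\<close>

lemma movable_component:
  assumes "acyclic R" and ok: "compatible P Q" and ne: "P \<noteq> {} \<or> Q \<noteq> {}"
  shows "(\<exists>i \<in> P. compatible (P - {i}) Q) \<or> (\<exists>j \<in> Q. compatible P (Q - {j}))"
proof (rule ccontr)
  assume stuck: "\<not> ?thesis"
  define Z where "Z = {y \<in> Y. cidx \<Phi> y \<in> P \<and> cidx \<Psi> y \<in> Q}"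
  have block_\<Phi>: "\<exists>y \<in> Z. lab \<Phi> y = - 1 \<and> cidx \<Phi> y = i" if "i \<in> P" for i
  proof -
    have "\<not> compatible (P - {i}) Q" using stuck that by blast
    then obtain y where "y \<in> Y" "\<not> (if lab \<Phi> y = 1 then cidx \<Phi> y \<in> P - {i} \<longrightarrow> cidx \<Psi> y \<in> Q
        else cidx \<Psi> y \<in> Q \<longrightarrow> cidx \<Phi> y \<in> P - {i})"
      unfolding compatible_def by blast
    then show ?thesis
      using ok sign[of y] unfolding compatible_def Z_def by (auto split: if_splits)
  qed
  have block_\<Psi>: "\<exists>y \<in> Z. lab \<Phi> y = 1 \<and> cidx \<Psi> y = j" if "j \<in> Q" for j
  proof -
    have "\<not> compatible P (Q - {j})" using stuck that by blast
    then obtain y where "y \<in> Y" "\<not> (if lab \<Phi> y = 1 then cidx \<Phi> y \<in> P \<longrightarrow> cidx \<Psi> y \<in> Q - {j}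
        else cidx \<Psi> y \<in> Q - {j} \<longrightarrow> cidx \<Phi> y \<in> P)"
      unfolding compatible_def by blast
    then show ?thesis
      using ok sign[of y] unfolding compatible_def Z_def by (auto split: if_splits)
  qed
  have "R \<subseteq> Y \<times> Y" by (auto simp: precedes_def)
  then have "wf R"
    using assms(1) finite_subset[of R "Y \<times> Y"] by (intro finite_acyclic_wf) auto
  moreover obtain y\<^sub>0 where "y\<^sub>0 \<in> Z" using block_\<Phi> block_\<Psi> ne by blast
  ultimately obtain y where y: "y \<in> Z" and min: "\<And>z. (z, y) \<in> R \<Longrightarrow> z \<notin> Z"
    using wfE_min[of R y\<^sub>0 Z] by blast
  have "y \<in> Y" "cidx \<Phi> y \<in> P" "cidx \<Psi> y \<in> Q" using y by (auto simp: Z_def)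
  then obtain z where "z \<in> Z" "(z, y) \<in> R"
    using block_\<Phi>[of "cidx \<Phi> y"] block_\<Psi>[of "cidx \<Psi> y"] sign[of y]
    by (fastforce simp: precedes_def Z_def)
  then show False using min by blast
qed

end

text \<open>The composites of \<open>\<gamma>\<close> and \<open>\<delta>\<close> at intermediate stages: the tuple of arguments of \<open>F\<close> runs from
  \<open>start\<close>, the tuple of arguments of \<open>H\<close> runs to \<open>finish\<close>; these are the outer tuples of objects in both
  sides of the g-dinaturality equation for the composition. The equation says that \<open>total\<close>
  has the same value when no component and when every component has moved.\<close>

locale composable_families = composable_graphs \<Phi> \<Psi> + arrow A f
  for \<Phi> \<Psi> :: "'v graph" and A :: "('o, 'm) cat" and f +
  fixes F G H \<gamma> \<delta>
  assumes F: "is_functor (places_cat A (lab \<Phi>) (lhs \<Phi>)) A F"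
    and G: "is_functor (places_cat A (lab \<Phi>) (rhs \<Phi>)) A G"
    and H: "is_functor (places_cat A (lab \<Psi>) (rhs \<Psi>)) A H"
    and \<gamma>: "g_dinatural A \<Phi> F G \<gamma>"
    and \<delta>: "g_dinatural A \<Psi> G H \<delta>"
begin

definition at_\<Phi> :: "nat set \<Rightarrow> 'v \<Rightarrow> bool" where "at_\<Phi> P u = (cidx \<Phi> u \<in> P)"
definition at_\<Psi> :: "nat set \<Rightarrow> 'v \<Rightarrow> bool" where "at_\<Psi> Q u = (cidx \<Psi> u \<in> Q)"

definition start :: "'v \<Rightarrow> bool" where "start x = (lab \<Phi> x \<noteq> 1)"
definition finish :: "'v \<Rightarrow> bool" where "finish z = (lab \<Psi> z = 1)"

definition fam_\<Phi> where "fam_\<Phi> P = \<gamma> (stage (ncomp \<Phi>) (\<lambda>i. i \<in> P))"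
definition fam_\<Psi> where "fam_\<Psi> Q = \<delta> (stage (ncomp \<Psi>) (\<lambda>j. j \<in> Q))"

definition from_F where "from_F P = mor_at F (lab \<Phi>) (lhs \<Phi>) start (at_\<Phi> P)"
definition through_G where "through_G P Q = mor_at G (lab \<Phi>) (rhs \<Phi>) (at_\<Phi> P) (at_\<Psi> Q)"
definition to_H where "to_H Q = mor_at H (lab \<Psi>) (rhs \<Psi>) (at_\<Psi> Q) finish"

definition total where
  "total P Q = Cmp A (Cmp A (to_H Q) (fam_\<Psi> Q))
     (Cmp A (through_G P Q) (Cmp A (fam_\<Phi> P) (from_F P)))"

lemma G': "is_functor (places_cat A (lab \<Psi>) (lhs \<Psi>)) A G"
proof -
  have "places_cat A (lab \<Psi>) (lhs \<Psi>) = places_cat A (lab \<Phi>) (rhs \<Phi>)"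
    unfolding places_cat_def middle
    by (intro arg_cong[where f = prod_cat]) (simp add: middle_sign)
  then show ?thesis using G by simp
qed

lemma through_G': "through_G P Q = mor_at G (lab \<Psi>) (lhs \<Psi>) (at_\<Phi> P) (at_\<Psi> Q)"
  unfolding through_G_def middle by (intro mor_at_cong) (simp_all add: middle_sign)

lemma from_F_hom:
  "from_F P \<in> Hom A (obj_at F (lhs \<Phi>) start) (obj_at F (lhs \<Phi>) (at_\<Phi> P))"
  unfolding from_F_def by (rule mor_at_hom[OF F]) (simp add: signed_le_def start_def)

lemma to_H_hom:
  "to_H Q \<in> Hom A (obj_at H (rhs \<Psi>) (at_\<Psi> Q)) (obj_at H (rhs \<Psi>) finish)"
  unfolding to_H_def by (rule mor_at_hom[OF H]) (simp add: signed_le_def finish_def)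

lemma compatible_signed_le:
  "compatible P Q \<Longrightarrow> y \<in> Y \<Longrightarrow> signed_le (lab \<Phi>) (at_\<Phi> P) (at_\<Psi> Q) y"
  by (auto simp: compatible_def signed_le_def at_\<Phi>_def at_\<Psi>_def)

lemma through_G_hom:
  assumes "compatible P Q"
  shows "through_G P Q \<in> Hom A (obj_at G (rhs \<Phi>) (at_\<Phi> P)) (obj_at G (rhs \<Phi>) (at_\<Psi> Q))"
  unfolding through_G_def by (rule mor_at_hom[OF G]) (rule compatible_signed_le[OF assms])

lemma fam_\<Phi>_hom:
  "fam_\<Phi> P \<in> Hom A (obj_at F (lhs \<Phi>) (at_\<Phi> P)) (obj_at G (rhs \<Phi>) (at_\<Phi> P))"
  using family_hom[OF \<Phi> \<gamma>, of "\<lambda>i. i \<in> P"] unfolding fam_\<Phi>_def at_\<Phi>_def .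

lemma fam_\<Psi>_hom:
  "fam_\<Psi> Q \<in> Hom A (obj_at G (rhs \<Phi>) (at_\<Psi> Q)) (obj_at H (rhs \<Psi>) (at_\<Psi> Q))"
  using family_hom[OF \<Psi> \<delta>, of "\<lambda>i. i \<in> Q"] unfolding fam_\<Psi>_def at_\<Psi>_def middle .

lemma total_regrouped:
  assumes "compatible P Q"
  shows "total P Q = Cmp A (Cmp A (to_H Q) (Cmp A (fam_\<Psi> Q) (through_G P Q)))
     (Cmp A (fam_\<Phi> P) (from_F P))"
proof -
  have "total P Q = Cmp A (Cmp A (Cmp A (to_H Q) (fam_\<Psi> Q)) (through_G P Q))
      (Cmp A (fam_\<Phi> P) (from_F P))"
    unfolding total_def
    by (rule cat_assoc[OF cat_comp[OF from_F_hom fam_\<Phi>_hom] through_G_hom[OF assms]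
          cat_comp[OF fam_\<Psi>_hom to_H_hom]])
  also have "Cmp A (Cmp A (to_H Q) (fam_\<Psi> Q)) (through_G P Q) =
      Cmp A (to_H Q) (Cmp A (fam_\<Psi> Q) (through_G P Q))"
    by (rule cat_assoc[symmetric, OF through_G_hom[OF assms] fam_\<Psi>_hom to_H_hom])
  finally show ?thesis .
qed

lemma upd_mem:
  "i \<in> P \<Longrightarrow> (\<lambda>j. j \<in> P)(i := True) = (\<lambda>j. j \<in> P)"
  "(\<lambda>j. j \<in> P)(i := False) = (\<lambda>j. j \<in> P - {i})"
  by (auto simp: fun_eq_iff)

lemma move_\<Phi>:
  assumes "i \<in> P" "P \<subseteq> {..<ncomp \<Phi>}" "compatible P Q" "compatible (P - {i}) Q"
  shows "total P Q = total (P - {i}) Q"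
proof -
  have i: "i < ncomp \<Phi>" using assms by auto
  have hi: "signed_le (lab \<Phi>) (\<lambda>u. ((\<lambda>j. j \<in> P)(i := x)) (cidx \<Phi> u)) (at_\<Psi> Q) u"
    if "u \<in> Y" for u x
    using compatible_signed_le[OF assms(3) that] compatible_signed_le[OF assms(4) that] assms(1)
    by (cases x) (auto simp: signed_le_def at_\<Phi>_def split: if_splits)
  have "Cmp A (through_G P Q) (Cmp A (fam_\<Phi> P) (from_F P)) =
      Cmp A (through_G (P - {i}) Q) (Cmp A (fam_\<Phi> (P - {i})) (from_F (P - {i})))"
    using slide_component[OF \<Phi> \<gamma> F G i _ hi, of start, unfolded upd_mem(1)[OF assms(1)] upd_mem(2)]
    unfolding through_G_def fam_\<Phi>_def from_F_def at_\<Phi>_def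
    by (simp add: signed_le_def start_def)
  then show ?thesis unfolding total_def by simp
qed

lemma move_\<Psi>:
  assumes "j \<in> Q" "Q \<subseteq> {..<ncomp \<Psi>}" "compatible P Q" "compatible P (Q - {j})"
  shows "total P Q = total P (Q - {j})"
proof -
  have j: "j < ncomp \<Psi>" using assms by auto
  have lo: "signed_le (lab \<Psi>) (at_\<Phi> P) (\<lambda>u. ((\<lambda>i. i \<in> Q)(j := x)) (cidx \<Psi> u)) u"
    if "u \<in> set (lhs \<Psi>)" for u x
  proof -
    have u: "u \<in> Y" using that by (simp add: middle)
    show ?thesis
      using compatible_signed_le[OF assms(3) u] compatible_signed_le[OF assms(4) u] assms(1)
        middle_sign[OF u]
      by (cases x) (auto simp: signed_le_def at_\<Psi>_def split: if_splits)
  qed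
  have "Cmp A (to_H Q) (Cmp A (fam_\<Psi> Q) (through_G P Q)) =
      Cmp A (to_H (Q - {j})) (Cmp A (fam_\<Psi> (Q - {j})) (through_G P (Q - {j})))"
    using slide_component[OF \<Psi> \<delta> G' H j lo, where b' = finish,
        unfolded upd_mem(1)[OF assms(1)] upd_mem(2)]
    unfolding through_G' fam_\<Psi>_def to_H_def at_\<Psi>_def
    by (simp add: signed_le_def finish_def)
  then show ?thesis
    using assms(3,4) by (simp add: total_regrouped)
qed

lemma total_constant:
  assumes "acyclic R"
  shows "finite P \<Longrightarrow> finite Q \<Longrightarrow> P \<subseteq> {..<ncomp \<Phi>} \<Longrightarrow> Q \<subseteq> {..<ncomp \<Psi>} \<Longrightarrow>
    compatible P Q \<Longrightarrow> total P Q = total {} {}"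
proof (induction "card P + card Q" arbitrary: P Q rule: less_induct)
  case less
  show ?case
  proof (cases "P = {} \<and> Q = {}")
    case False
    then consider i where "i \<in> P" "compatible (P - {i}) Q" | j where "j \<in> Q" "compatible P (Q - {j})"
      using movable_component[OF assms less.prems(5)] by blast
    then show ?thesis
    proof cases
      case (1 i)
      have "card (P - {i}) < card P"
        using 1(1) less.prems(1) by (rule card_Diff1_less[rotated])
      then have "total (P - {i}) Q = total {} {}"
        using less.prems 1 by (intro less.hyps) auto
      then show ?thesis using move_\<Phi>[OF 1(1) less.prems(3,5) 1(2)] by simp
    next
      case (2 j)
      have "card (Q - {j}) < card Q"
        using 2(1) less.prems(2) by (rule card_Diff1_less[rotated])
      then have "total P (Q - {j}) = total {} {}"
        using less.prems 2 by (intro less.hyps) auto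
      then show ?thesis using move_\<Psi>[OF 2(1) less.prems(4,5) 2(2)] by simp
    qed
  qed auto
qed

lemma sign_in_composition:
  "x \<in> set (lhs \<Phi>) \<Longrightarrow> lab composite (Some x) = lab \<Phi> x"
  "z \<in> set (rhs \<Psi>) \<Longrightarrow> lab composite (Some z) = lab \<Psi> z"
proof -
  show "x \<in> set (lhs \<Phi>) \<Longrightarrow> lab composite (Some x) = lab \<Phi> x"
    by (simp add: composition_def)
  assume z: "z \<in> set (rhs \<Psi>)"
  have "z \<notin> set (lhs \<Phi>)"
  proof
    assume "z \<in> set (lhs \<Phi>)"
    then have "z \<in> set (lhs \<Psi>)"
      unfolding middle using z by (intro shared_vertex) (auto simp: verts_def args_def)
    then show False using z \<Psi> by (auto simp: is_graph_def)
  qed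
  then show "lab composite (Some z) = lab \<Psi> z"
    by (simp add: composition_def)
qed

text \<open>When all components are at the same end of \<open>f\<close>, the morphism in the middle is an identity and
  \<open>total\<close> is a side of the g-dinaturality equation for the composition: the left-hand side for
  \<open>b = True\<close>, the right-hand side for \<open>b = False\<close>.\<close>

lemma total_at_ends:
  assumes "length As = 1" and P: "P = (if b then {..<ncomp \<Phi>} else {})"
    and Q: "Q = (if b then {..<ncomp \<Psi>} else {})"
  shows "Cmp A (mmap H (mors A composite As 0 (ar b True) (ar False b) (rhs composite)))
      (Cmp A (comp_family A \<Psi> \<Phi> \<delta> \<gamma> (As[0 := ob b]))
        (mmap F (mors A composite As 0 (ar False b) (ar b True) (lhs composite)))) =
    total P Q"
    and "comp_family A \<Psi> \<Phi> \<delta> \<gamma> (As[0 := ob b]) = Cmp A (fam_\<Psi> Q) (fam_\<Phi> P)"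
    and "omap F (objs composite (As[0 := ob b]) (lhs composite)) =
      obj_at F (lhs \<Phi>) (at_\<Phi> P)"
    and "omap H (objs composite (As[0 := ob b]) (rhs composite)) =
      obj_at H (rhs \<Psi>) (at_\<Psi> Q)"
    and "compatible P Q"
proof -
  have at: "u \<in> set (lhs \<Phi>) \<Longrightarrow> at_\<Phi> P u = b" "u \<in> Y \<Longrightarrow> at_\<Phi> P u = b"
    "u \<in> Y \<Longrightarrow> at_\<Psi> Q u = b" "u \<in> set (rhs \<Psi>) \<Longrightarrow> at_\<Psi> Q u = b" for u
    using place_component_in_range[OF \<Phi>] place_component_in_range[OF \<Psi>]
    by (auto simp: at_\<Phi>_def at_\<Psi>_def P Q middle)
  show ok: "compatible P Q"
    using at by (auto simp: compatible_def at_\<Phi>_def at_\<Psi>_def)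
  obtain X where As: "As = [X]"
    using assms(1) by (auto simp: length_Suc_conv)
  have "stage (ncomp \<Phi>) (\<lambda>i. i \<in> P) = replicate (ncomp \<Phi>) (ob b)"
    "stage (ncomp \<Psi>) (\<lambda>i. i \<in> Q) = replicate (ncomp \<Psi>) (ob b)"
    by (auto simp: stage_def P Q intro!: nth_equalityI)
  then show fam: "comp_family A \<Psi> \<Phi> \<delta> \<gamma> (As[0 := ob b]) = Cmp A (fam_\<Psi> Q) (fam_\<Phi> P)"
    by (simp add: comp_family_def fam_\<Phi>_def fam_\<Psi>_def As)
  show "omap F (objs composite (As[0 := ob b]) (lhs composite)) =
      obj_at F (lhs \<Phi>) (at_\<Phi> P)"
    by (simp add: obj_at_def objs_def composition_def As at cong: map_cong)
  show "omap H (objs composite (As[0 := ob b]) (rhs composite)) =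
      obj_at H (rhs \<Psi>) (at_\<Psi> Q)"
    by (simp add: obj_at_def objs_def composition_def As at cong: map_cong)
  have shape: "lhs composite = map Some (lhs \<Phi>)" "rhs composite = map Some (rhs \<Psi>)"
    "cidx composite u = 0" for u
    by (simp_all add: composition_def)
  have "mors A composite As 0 (ar False b) (ar b True) (lhs composite) =
      map (signed_ar (lab \<Phi>) start (at_\<Phi> P)) (lhs \<Phi>)"
    unfolding mors_def shape
    by (auto simp: sign_in_composition signed_ar_def start_def at)
  then have F': "mmap F (mors A composite As 0 (ar False b) (ar b True)
      (lhs composite)) = from_F P"
    by (simp add: from_F_def mor_at_def)
  have "mors A composite As 0 (ar b True) (ar False b) (rhs composite) =
      map (signed_ar (lab \<Psi>) (at_\<Psi> Q) finish) (rhs \<Psi>)"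
    unfolding mors_def shape
    by (auto simp: sign_in_composition signed_ar_def finish_def at)
  then have H': "mmap H (mors A composite As 0 (ar b True) (ar False b)
      (rhs composite)) = to_H Q"
    by (simp add: to_H_def mor_at_def)
  have obj: "obj_at G (rhs \<Phi>) (at_\<Psi> Q) = obj_at G (rhs \<Phi>) (at_\<Phi> P)"
    by (rule obj_at_cong) (simp add: at)
  have "through_G P Q = mor_at G (lab \<Phi>) (rhs \<Phi>) (at_\<Phi> P) (at_\<Phi> P)"
    unfolding through_G_def by (rule mor_at_cong) (simp_all add: at)
  then have "through_G P Q = Idm A (obj_at G (rhs \<Phi>) (at_\<Phi> P))"
    by (simp add: mor_at_same[OF G])
  then have tot: "total P Q = Cmp A (Cmp A (to_H Q) (fam_\<Psi> Q)) (Cmp A (fam_\<Phi> P) (from_F P))"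
    unfolding total_def using cat_comp_id_left[OF cat_comp[OF from_F_hom fam_\<Phi>_hom]] by simp
  have d: "fam_\<Psi> Q \<in> Hom A (obj_at G (rhs \<Phi>) (at_\<Phi> P)) (obj_at H (rhs \<Psi>) (at_\<Psi> Q))"
    using fam_\<Psi>_hom[of Q] obj by simp
  have "Cmp A (to_H Q) (Cmp A (Cmp A (fam_\<Psi> Q) (fam_\<Phi> P)) (from_F P)) =
      Cmp A (to_H Q) (Cmp A (fam_\<Psi> Q) (Cmp A (fam_\<Phi> P) (from_F P)))"
    by (simp add: cat_assoc[OF from_F_hom fam_\<Phi>_hom d])
  also have "\<dots> = total P Q"
    unfolding tot by (rule cat_assoc[OF cat_comp[OF from_F_hom fam_\<Phi>_hom] d to_H_hom])
  finally show "Cmp A (mmap H (mors A composite As 0 (ar b True) (ar False b) (rhs composite)))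
      (Cmp A (comp_family A \<Psi> \<Phi> \<delta> \<gamma> (As[0 := ob b]))
        (mmap F (mors A composite As 0 (ar False b) (ar b True) (lhs composite)))) =
    total P Q"
    unfolding F' H' fam .
qed

lemma composite_in_hom:
  assumes "length As = 1"
  shows "comp_family A \<Psi> \<Phi> \<delta> \<gamma> (As[0 := ob b]) \<in>
    Hom A (omap F (objs composite (As[0 := ob b]) (lhs composite)))
      (omap H (objs composite (As[0 := ob b]) (rhs composite)))"
proof -
  define P where "P = (if b then {..<ncomp \<Phi>} else {})"
  define Q where "Q = (if b then {..<ncomp \<Psi>} else {})"
  note ext = total_at_ends[OF assms P_def Q_def]
  have "u \<in> Y \<Longrightarrow> at_\<Psi> Q u = at_\<Phi> P u" for u
    using place_component_in_range[OF \<Phi>] place_component_in_range[OF \<Psi>]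
    by (auto simp: at_\<Phi>_def at_\<Psi>_def P_def Q_def middle)
  then have "obj_at G (rhs \<Phi>) (at_\<Psi> Q) = obj_at G (rhs \<Phi>) (at_\<Phi> P)"
    by (rule obj_at_cong)
  then show ?thesis
    unfolding ext(2-4) using cat_comp[OF fam_\<Phi>_hom] fam_\<Psi>_hom by metis
qed

lemma composite_dinatural_equation:
  assumes "acyclic R" "length As = 1"
  shows "Cmp A (mmap H (mors A composite As 0 (Idm A (Cod A f)) f (rhs composite)))
      (Cmp A (comp_family A \<Psi> \<Phi> \<delta> \<gamma> (As[0 := Cod A f]))
        (mmap F (mors A composite As 0 f (Idm A (Cod A f)) (lhs composite)))) =
    Cmp A (mmap H (mors A composite As 0 f (Idm A (Dom A f)) (rhs composite)))
      (Cmp A (comp_family A \<Psi> \<Phi> \<delta> \<gamma> (As[0 := Dom A f]))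
        (mmap F (mors A composite As 0 (Idm A (Dom A f)) f (lhs composite))))"
proof -
  have "compatible {..<ncomp \<Phi>} {..<ncomp \<Psi>}"
    using total_at_ends(5)[OF assms(2), of _ True] by simp
  then have "total {..<ncomp \<Phi>} {..<ncomp \<Psi>} = total {} {}"
    by (intro total_constant[OF assms(1)]) auto
  then show ?thesis
    using total_at_ends(1)[OF assms(2), of _ True, OF refl refl]
      total_at_ends(1)[OF assms(2), of _ False, OF refl refl]
    by (simp add: ar_def ob_def)
qed

end

theorem (in composable_graphs) composite_g_dinatural_if_acyclic:
  assumes "acyclic R" and A: "is_category A"
    and F: "is_functor (places_cat A (lab \<Phi>) (lhs \<Phi>)) A F"
    and G: "is_functor (places_cat A (lab \<Phi>) (rhs \<Phi>)) A G"
    and H: "is_functor (places_cat A (lab \<Psi>) (rhs \<Psi>)) A H"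
    and \<gamma>: "g_dinatural A \<Phi> F G \<gamma>"
    and \<delta>: "g_dinatural A \<Psi> G H \<delta>"
  shows "g_dinatural A composite F H (comp_family A \<Psi> \<Phi> \<delta> \<gamma>)"
proof -
  have families: "composable_families \<Phi> \<Psi> A f F G H \<gamma> \<delta>" if "f \<in> Mor A" for f
    using assms that \<Phi> \<Psi> comp by unfold_locales
  have one: "ncomp composite = 1" by (simp add: composition_def)
  have "comp_family A \<Psi> \<Phi> \<delta> \<gamma> As \<in>
      Hom A (omap F (objs composite As (lhs composite)))
        (omap H (objs composite As (rhs composite)))"
    if As: "length As = 1" "set As \<subseteq> Ob A" for As
  proof -
    obtain X where X: "As = [X]" using As(1) by (auto simp: length_Suc_conv)
    then have id: "Idm A X \<in> Hom A X X" using A As(2) by (simp add: is_category_def)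
    \<comment> \<open>An identity serves as the morphism over which the value at an object is described.\<close>
    interpret composable_families \<Phi> \<Psi> A "Idm A X" F G H \<gamma> \<delta>
      using id by (intro families) (simp add: Hom_iff)
    have "As[0 := ob True] = As" using id by (simp add: X ob_def Hom_iff)
    then show ?thesis using composite_in_hom[OF As(1), of True] by simp
  qed
  then show ?thesis
    unfolding g_dinatural_def one Let_def
    using composable_families.composite_dinatural_equation[OF families assms(1)] by auto
qed

section \<open>A cycle yields a composition that is not g-dinatural\<close>

text \<open>Tuples are lists; as the places are distinct, a tuple can be written as a function of the place.\<close>

lemma distinct_list_as_map:
  assumes "distinct us" "length xs = length us"
  shows "\<exists>w. xs = map w us"
  using assms
proof (induction us arbitrary: xs)
  case Nil
  then show ?case by simp
next
  case (Cons u us)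
  then obtain x xs' where xs: "xs = x # xs'" "length xs' = length us"
    by (cases xs) auto
  with Cons obtain w where "xs' = map w us" by auto
  then have "xs = map (w(u := x)) (u # us)"
    using xs Cons.prems(1) by auto
  then show ?case by blast
qed

lemma functor_on_placesI:
  assumes "distinct us"
    and "\<And>\<phi>. \<forall>u \<in> set us. \<phi> u \<in> Ob A \<Longrightarrow> omap T (map \<phi> us) \<in> Ob D"
    and "\<And>w. \<forall>u \<in> set us. w u \<in> Mor A \<Longrightarrow> mmap T (map w us) \<in>
      Hom D (omap T (map (\<lambda>u. if l u = 1 then Dom A (w u) else Cod A (w u)) us))
        (omap T (map (\<lambda>u. if l u = 1 then Cod A (w u) else Dom A (w u)) us))"
    and "\<And>\<phi>. \<forall>u \<in> set us. \<phi> u \<in> Ob A \<Longrightarrow>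
      mmap T (map (\<lambda>u. Idm A (\<phi> u)) us) = Idm D (omap T (map \<phi> us))"
    and "\<And>w w'. \<forall>u \<in> set us. w u \<in> Mor A \<and> w' u \<in> Mor A \<and>
        (if l u = 1 then Cod A (w u) = Dom A (w' u) else Dom A (w u) = Cod A (w' u)) \<Longrightarrow>
      mmap T (map (\<lambda>u. if l u = 1 then Cmp A (w' u) (w u) else Cmp A (w u) (w' u)) us) =
      Cmp D (mmap T (map w' us)) (mmap T (map w us))"
  shows "is_functor (places_cat A l us) D T"
proof -
  have ob: "\<exists>\<phi>. xs = map \<phi> us \<and> (\<forall>u \<in> set us. \<phi> u \<in> Ob A)"
    if "xs \<in> Ob (places_cat A l us)" for xs
  proof -
    have "length xs = length us" using that by (simp add: places_cat_def prod_cat_def)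
    then obtain \<phi> where "xs = map \<phi> us" using distinct_list_as_map[OF assms(1)] by blast
    then show ?thesis using that by (auto simp: Ob_places_iff)
  qed
  have mor: "\<exists>w. ms = map w us \<and> (\<forall>u \<in> set us. w u \<in> Mor A)"
    if "ms \<in> Mor (places_cat A l us)" for ms
  proof -
    have "length ms = length us" using that by (simp add: places_cat_def prod_cat_def)
    then obtain w where "ms = map w us" using distinct_list_as_map[OF assms(1)] by blast
    then show ?thesis using that by (auto simp: Mor_places_iff)
  qed
  have "mmap T (Cmp (places_cat A l us) ms' ms) = Cmp D (mmap T ms') (mmap T ms)"
    if ms: "ms \<in> Mor (places_cat A l us)" "ms' \<in> Mor (places_cat A l us)"
      "Cod (places_cat A l us) ms = Dom (places_cat A l us) ms'" for ms ms'
  proof -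
    obtain w where w: "ms = map w us" "\<forall>u \<in> set us. w u \<in> Mor A" using mor[OF ms(1)] by blast
    obtain w' where w': "ms' = map w' us" "\<forall>u \<in> set us. w' u \<in> Mor A" using mor[OF ms(2)] by blast
    have "\<forall>u \<in> set us. if l u = 1 then Cod A (w u) = Dom A (w' u) else Dom A (w u) = Cod A (w' u)"
      using ms(3) by (auto simp: w w' Cod_places Dom_places split: if_splits)
    then show ?thesis
      using w w' assms(5)[of w w'] by (simp add: Cmp_places)
  qed
  moreover have "omap T xs \<in> Ob D" "mmap T (Idm (places_cat A l us) xs) = Idm D (omap T xs)"
    if "xs \<in> Ob (places_cat A l us)" for xs
    using ob[OF that] assms(2,4) by (auto simp: Idm_places)
  moreover have "mmap T ms \<in> Hom D (omap T (Dom (places_cat A l us) ms))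
      (omap T (Cod (places_cat A l us) ms))"
    if "ms \<in> Mor (places_cat A l us)" for ms
    using mor[OF that] assms(3) by (auto simp: Dom_places Cod_places)
  ultimately show ?thesis
    unfolding is_functor_def by blast
qed

text \<open>The category of the counterexample: the integers with their order, and one more endomorphism of
  \<open>0\<close>, the marked one. It is idempotent, and a composite is marked if it runs from \<open>0\<close> to \<open>0\<close> and one of
  its factors is marked. Morphisms that start or end elsewhere never carry a mark, so two
  composites with the same negative source and the same target are equal. The injections \<open>obj\<close> and
  \<open>mor\<close> place this countable category in the given types.\<close>

locale marked_integers =
  fixes obj :: "int \<Rightarrow> 'o" and mor :: "int \<times> int \<times> bool \<Rightarrow> 'm"
  assumes inj_obj: "inj obj" and inj_mor: "inj mor"
begin

definition level :: "'o \<Rightarrow> int" where "level = inv obj"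

definition src :: "'m \<Rightarrow> int" where "src m = fst (inv mor m)"
definition tgt :: "'m \<Rightarrow> int" where "tgt m = fst (snd (inv mor m))"
definition mark :: "'m \<Rightarrow> bool" where "mark m = snd (snd (inv mor m))"

text \<open>Marks outside of the endomorphisms of \<open>0\<close> are erased, so that \<open>arr\<close> may be used with any mark.\<close>

definition arr :: "int \<Rightarrow> int \<Rightarrow> bool \<Rightarrow> 'm" where
  "arr s t k = mor (s, t, s = 0 \<and> t = 0 \<and> k)"

definition Z :: "('o, 'm) cat" where
  "Z = \<lparr>Ob = range obj, Mor = {arr s t k | s t k. s \<le> t},
     Dom = (\<lambda>m. obj (src m)), Cod = (\<lambda>m. obj (tgt m)), Idm = (\<lambda>X. arr (level X) (level X) False),
     Cmp = (\<lambda>m' m. arr (src m) (tgt m') (mark m' \<or> mark m))\<rparr>"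

lemma level_obj [simp]: "level (obj n) = n"
  by (simp add: level_def inj_obj)

lemma arr_simps [simp]:
  "src (arr s t k) = s" "tgt (arr s t k) = t" "mark (arr s t k) \<longleftrightarrow> s = 0 \<and> t = 0 \<and> k"
  by (simp_all add: src_def tgt_def mark_def arr_def inj_mor)

lemma obj_eq_iff [simp]: "obj m = obj n \<longleftrightarrow> m = n"
  using inj_obj by (auto dest: injD)

lemma arr_eqI: "s = s' \<Longrightarrow> t = t' \<Longrightarrow> (s = 0 \<Longrightarrow> t = 0 \<Longrightarrow> k = k') \<Longrightarrow> arr s t k = arr s' t' k'"
  by (cases "s = 0"; cases "t = 0") (simp_all add: arr_def)

lemma Z_simps [simp]:
  "Dom Z m = obj (src m)" "Cod Z m = obj (tgt m)"
  "Idm Z X = arr (level X) (level X) False"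
  "Cmp Z m' m = arr (src m) (tgt m') (mark m' \<or> mark m)"
  by (simp_all add: Z_def)

lemma obj_in_Z [simp]: "obj n \<in> Ob Z"
  by (simp add: Z_def)

lemma arr_in_Z [simp]: "arr s t k \<in> Mor Z \<longleftrightarrow> s \<le> t"
proof
  assume "arr s t k \<in> Mor Z"
  then obtain s' t' k' where "arr s t k = arr s' t' k'" "s' \<le> t'" by (auto simp: Z_def)
  then show "s \<le> t" by (metis arr_simps(1,2))
qed (auto simp: Z_def)

lemma Ob_Z_E: "X \<in> Ob Z \<Longrightarrow> (\<And>n. X = obj n \<Longrightarrow> P) \<Longrightarrow> P"
  by (auto simp: Z_def)

lemma Mor_Z_E: "m \<in> Mor Z \<Longrightarrow> (\<And>s t k. m = arr s t k \<Longrightarrow> s \<le> t \<Longrightarrow> P) \<Longrightarrow> P"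
  by (auto simp: Z_def)

lemma src_le_tgt: "m \<in> Mor Z \<Longrightarrow> src m \<le> tgt m"
  by (erule Mor_Z_E) simp

lemma Z_category: "is_category Z"
  unfolding is_category_def
  by (auto simp: Hom_iff elim!: Mor_Z_E Ob_Z_E intro!: arr_eqI)

definition pos :: "int \<Rightarrow> int" where "pos n = (if 0 < n then 1 else 0)"

lemma pos_mono: "s \<le> t \<Longrightarrow> pos s \<le> pos t"
  by (simp add: pos_def)

definition const_functor :: "('o list, 'm list, 'o, 'm) functr" where
  "const_functor = \<lparr>omap = (\<lambda>_. obj 0), mmap = (\<lambda>_. arr 0 0 False)\<rparr>"

lemma const_functor: "is_functor C Z const_functor"
  by (simp add: is_functor_def const_functor_def Hom_iff)

text \<open>A functor that sees only whether an argument is positive, and adds up the weights of the places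
  with a positive argument. If the weights have the signs of the places, the sum can only grow along a morphism of tuples.\<close>

definition sum_functor :: "('v \<Rightarrow> int) \<Rightarrow> 'v list \<Rightarrow> ('v \<Rightarrow> int) \<Rightarrow> ('o list, 'm list, 'o, 'm) functr" where
  "sum_functor l us wt = \<lparr>
     omap = (\<lambda>xs. obj (sum_list (map2 (\<lambda>u X. wt u * pos (level X)) us xs))),
     mmap = (\<lambda>ms. arr (sum_list (map2 (\<lambda>u m. wt u * pos (if l u = 1 then src m else tgt m)) us ms))
       (sum_list (map2 (\<lambda>u m. wt u * pos (if l u = 1 then tgt m else src m)) us ms)) False)\<rparr>"

lemma map2_map: "map2 h us (map g us) = map (\<lambda>u. h u (g u)) us"
  by (induction us) auto

context
  fixes l :: "'v \<Rightarrow> int" and us :: "'v list" and wt :: "'v \<Rightarrow> int"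
  assumes us: "distinct us"
begin

lemma omap_sum_functor:
  "omap (sum_functor l us wt) (map \<phi> us) = obj (\<Sum>u\<in>set us. wt u * pos (level (\<phi> u)))"
  by (simp add: sum_functor_def map2_map us sum_list_distinct_conv_sum_set)

lemma mmap_sum_functor:
  "mmap (sum_functor l us wt) (map w us) =
    arr (\<Sum>u\<in>set us. wt u * pos (if l u = 1 then src (w u) else tgt (w u)))
      (\<Sum>u\<in>set us. wt u * pos (if l u = 1 then tgt (w u) else src (w u))) False"
  by (simp add: sum_functor_def map2_map us sum_list_distinct_conv_sum_set)

lemma sum_functor:
  assumes wt: "\<And>u. u \<in> set us \<Longrightarrow> if l u = 1 then 0 \<le> wt u else wt u \<le> 0"
  shows "is_functor (places_cat Z l us) Z (sum_functor l us wt)"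
proof (rule functor_on_placesI[OF us])
  fix w :: "'v \<Rightarrow> 'm"
  assume w: "\<forall>u \<in> set us. w u \<in> Mor Z"
  have "wt u * pos (if l u = 1 then src (w u) else tgt (w u)) \<le>
      wt u * pos (if l u = 1 then tgt (w u) else src (w u))" if "u \<in> set us" for u
    using wt[OF that] w that pos_mono[OF src_le_tgt[of "w u"]]
    by (auto intro: mult_left_mono mult_left_mono_neg split: if_splits)
  then have le: "(\<Sum>u\<in>set us. wt u * pos (if l u = 1 then src (w u) else tgt (w u))) \<le>
      (\<Sum>u\<in>set us. wt u * pos (if l u = 1 then tgt (w u) else src (w u)))"
    by (rule sum_mono)
  have lev: "level (if l u = 1 then Dom Z (w u) else Cod Z (w u)) =
      (if l u = 1 then src (w u) else tgt (w u))"
    "level (if l u = 1 then Cod Z (w u) else Dom Z (w u)) =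
      (if l u = 1 then tgt (w u) else src (w u))" for u
    by simp_all
  show "mmap (sum_functor l us wt) (map w us) \<in>
      Hom Z (omap (sum_functor l us wt) (map (\<lambda>u. if l u = 1 then Dom Z (w u) else Cod Z (w u)) us))
        (omap (sum_functor l us wt) (map (\<lambda>u. if l u = 1 then Cod Z (w u) else Dom Z (w u)) us))"
    unfolding omap_sum_functor mmap_sum_functor lev using le by (simp add: Hom_iff)
next
  fix \<phi> :: "'v \<Rightarrow> 'o"
  show "omap (sum_functor l us wt) (map \<phi> us) \<in> Ob Z"
    by (simp add: omap_sum_functor)
  show "mmap (sum_functor l us wt) (map (\<lambda>u. Idm Z (\<phi> u)) us) =
      Idm Z (omap (sum_functor l us wt) (map \<phi> us))"
    by (simp add: omap_sum_functor mmap_sum_functor cong: if_cong)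
next
  fix w w' :: "'v \<Rightarrow> 'm"
  show "mmap (sum_functor l us wt)
       (map (\<lambda>u. if l u = 1 then Cmp Z (w' u) (w u) else Cmp Z (w u) (w' u)) us) =
      Cmp Z (mmap (sum_functor l us wt) (map w' us)) (mmap (sum_functor l us wt) (map w us))"
    unfolding mmap_sum_functor
    by (auto intro!: arr_eqI sum.cong)
qed

end

end

locale composable_graphs_with_cycle = composable_graphs \<Phi> \<Psi>
  for \<Phi> \<Psi> :: "'v graph" +
  fixes n :: nat and y :: "nat \<Rightarrow> 'v"
  assumes n: "0 < n" and closed: "y n = y 0" and step: "i < n \<Longrightarrow> (y i, y (Suc i)) \<in> R"
begin

text \<open>The number of visits of the cycle to a place, with the sign of the place.\<close>

definition weight :: "'v \<Rightarrow> int" where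
  "weight u = (\<Sum>i<n. if y i = u then lab \<Phi> u else 0)"

definition height :: "('v \<Rightarrow> int) \<Rightarrow> int" where
  "height b = (\<Sum>u\<in>Y. weight u * b u)"

lemma y_in_Y: "i < n \<Longrightarrow> y i \<in> Y"
  using step[of i] by (auto simp: precedes_def)

lemma weight_sign: "u \<in> Y \<Longrightarrow> if lab \<Phi> u = 1 then 0 \<le> weight u else weight u \<le> 0"
  using sign[of u] by (auto simp: weight_def intro!: sum_nonneg sum_nonpos)

lemma height_along_cycle: "height b = (\<Sum>i<n. lab \<Phi> (y i) * b (y i))"
proof -
  have "height b = (\<Sum>u\<in>Y. \<Sum>i<n. if y i = u then lab \<Phi> u * b u else 0)"
    unfolding height_def weight_def sum_distrib_right
    by (intro sum.cong) auto
  also have "\<dots> = (\<Sum>i<n. \<Sum>u\<in>Y. if y i = u then lab \<Phi> u * b u else 0)"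
    by (rule sum.swap)
  also have "\<dots> = (\<Sum>i<n. lab \<Phi> (y i) * b (y i))"
    using y_in_Y by (intro sum.cong) auto
  finally show ?thesis .
qed

lemma cyclic_shift: "(\<Sum>i<n. g (y (Suc i))) = (\<Sum>i<n. g (y i))"
  for g :: "'v \<Rightarrow> int"
proof -
  have "(\<Sum>i<n. g (y (Suc i))) + g (y 0) = (\<Sum>i<n. g (y i)) + g (y n)"
    using sum.lessThan_Suc_shift[of "\<lambda>i. g (y i)" n] sum.lessThan_Suc[of "\<lambda>i. g (y i)" n] by simp
  then show ?thesis by (simp add: closed)
qed

lemma height_split:
  "height b = (\<Sum>i<n. if lab \<Phi> (y i) = 1 then b (y i) else 0)
    - (\<Sum>i<n. if lab \<Phi> (y i) = - 1 then b (y i) else 0)"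
proof -
  have "lab \<Phi> (y i) * b (y i) =
      (if lab \<Phi> (y i) = 1 then b (y i) else 0) - (if lab \<Phi> (y i) = - 1 then b (y i) else 0)"
    if "i < n" for i
    using sign[OF y_in_Y[OF that]] by auto
  then show ?thesis
    unfolding height_along_cycle sum_subtractf[symmetric] by (intro sum.cong) auto
qed

lemma next_sign: "i < n \<Longrightarrow> lab \<Phi> (y (Suc i)) = - lab \<Phi> (y i)"
  using step[of i] by (auto simp: precedes_def)

text \<open>On the cycle, positive and negative places alternate. Pairing each negative place with its
  successor gives pairs in components of \<open>\<Phi>\<close>, and pairing each positive place with its successor gives
  pairs in components of \<open>\<Psi>\<close>. So the height vanishes as soon as the argument is
  constant on the components of one of the graphs.\<close>

lemma height_\<Phi>:
  "height b = (\<Sum>i<n. if lab \<Phi> (y i) = - 1 then b (y (Suc i)) - b (y i) else 0)"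
  unfolding height_split cyclic_shift[of "\<lambda>u. if lab \<Phi> u = 1 then b u else 0", symmetric]
    sum_subtractf[symmetric]
  by (intro sum.cong) (auto simp: next_sign)

lemma height_\<Psi>:
  "height b = (\<Sum>i<n. if lab \<Phi> (y i) = 1 then b (y i) - b (y (Suc i)) else 0)"
  unfolding height_split cyclic_shift[of "\<lambda>u. if lab \<Phi> u = - 1 then b u else 0", symmetric]
    sum_subtractf[symmetric]
  by (intro sum.cong) (auto simp: next_sign)

lemma height_constant_\<Phi>:
  assumes "\<And>u v. u \<in> Y \<Longrightarrow> v \<in> Y \<Longrightarrow> cidx \<Phi> u = cidx \<Phi> v \<Longrightarrow> b u = b v"
  shows "height b = 0"
proof -
  have "(if lab \<Phi> (y i) = - 1 then b (y (Suc i)) - b (y i) else 0) = 0" if "i < n" for i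
    using step[OF that] assms[of "y i" "y (Suc i)"] by (auto simp: precedes_def)
  then show ?thesis unfolding height_\<Phi> by (intro sum.neutral) blast
qed

lemma height_constant_\<Psi>:
  assumes "\<And>u v. u \<in> Y \<Longrightarrow> v \<in> Y \<Longrightarrow> cidx \<Psi> u = cidx \<Psi> v \<Longrightarrow> b u = b v"
  shows "height b = 0"
proof -
  have "(if lab \<Phi> (y i) = 1 then b (y i) - b (y (Suc i)) else 0) = 0" if "i < n" for i
    using step[OF that] assms[of "y i" "y (Suc i)"] by (auto simp: precedes_def)
  then show ?thesis unfolding height_\<Psi> by (intro sum.neutral) blast
qed

lemma positive_on_cycle: obtains i where "i < n" "lab \<Phi> (y i) = 1"
proof (cases "lab \<Phi> (y 0) = 1")
  case True
  then show ?thesis using n that by blast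
next
  case False
  then have "lab \<Phi> (y 1) = 1" using step[of 0] n by (auto simp: precedes_def)
  moreover have "1 < n"
    using closed False calculation n by (cases "n = 1") auto
  ultimately show ?thesis using that by blast
qed

text \<open>A component of \<open>\<Psi>\<close> through which the cycle passes.\<close>

definition marked :: nat where
  "marked = cidx \<Psi> (y (SOME i. i < n \<and> lab \<Phi> (y i) = 1))"

lemma marked: obtains i where "i < n" "lab \<Phi> (y i) = 1" "cidx \<Psi> (y i) = marked" "marked < ncomp \<Psi>"
proof -
  define i where "i = (SOME i. i < n \<and> lab \<Phi> (y i) = 1)"
  have "\<exists>i. i < n \<and> lab \<Phi> (y i) = 1"
    by (rule positive_on_cycle) blast
  then have i: "i < n" "lab \<Phi> (y i) = 1"
    unfolding i_def by (metis (mono_tags, lifting) someI_ex)+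
  have "y i \<in> set (lhs \<Psi>)" unfolding middle by (rule y_in_Y[OF i(1)])
  then have "marked < ncomp \<Psi>"
    using place_component_in_range[OF \<Psi>] by (simp add: marked_def i_def)
  then show ?thesis using i by (intro that) (auto simp: marked_def i_def)
qed

text \<open>The middle tuple of objects that is the source in the g-dinaturality equation of \<open>\<Psi>\<close> for the
  component \<open>marked\<close>, when the source of the morphism is not positive and its target is. Each passage
  of the cycle through this component contributes \<open>-1\<close> to the height.\<close>

lemma height_negative:
  assumes const: "\<And>u v. u \<in> Y \<Longrightarrow> v \<in> Y \<Longrightarrow> cidx \<Psi> u = cidx \<Psi> v \<Longrightarrow> cidx \<Psi> u \<noteq> marked \<Longrightarrow> b u = b v"
    and pos: "\<And>u. u \<in> Y \<Longrightarrow> cidx \<Psi> u = marked \<Longrightarrow> lab \<Phi> u = 1 \<Longrightarrow> b u = 0"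
    and neg: "\<And>u. u \<in> Y \<Longrightarrow> cidx \<Psi> u = marked \<Longrightarrow> lab \<Phi> u = - 1 \<Longrightarrow> b u = 1"
  shows "height b < 0"
proof -
  let ?t = "\<lambda>i. if lab \<Phi> (y i) = 1 then b (y i) - b (y (Suc i)) else 0"
  obtain j where j: "j < n" "lab \<Phi> (y j) = 1" "cidx \<Psi> (y j) = marked" by (rule marked)
  have t: "?t i \<le> 0" if "i < n" for i
    using step[OF that] const[of "y i" "y (Suc i)"] pos[of "y i"] neg[of "y (Suc i)"]
    by (cases "cidx \<Psi> (y i) = marked") (auto simp: precedes_def)
  have tj: "?t j < 0"
    using step[OF j(1)] pos[of "y j"] neg[of "y (Suc j)"] j by (auto simp: precedes_def)
  have "sum ?t {..<n} < sum (\<lambda>_. 0) {..<n}"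
  proof (rule sum_strict_mono_ex1)
    show "\<exists>i \<in> {..<n}. ?t i < 0" using tj j(1) by blast
  qed (use t in auto)
  then show ?thesis unfolding height_\<Psi> by simp
qed

end

text \<open>Both outer functors are constant with value \<open>0\<close>, and the middle functor is the height. All values
  of the two families are endomorphisms of \<open>0\<close>; those of \<open>\<gamma>\<close> are identities, and \<open>\<delta>\<close> is marked if
  the object in the component \<open>marked\<close> is positive.\<close>

locale cycle_counterexample = composable_graphs_with_cycle \<Phi> \<Psi> n y + marked_integers obj mor
  for \<Phi> \<Psi> :: "'v graph" and n y and obj :: "int \<Rightarrow> 'o" and mor :: "int \<times> int \<times> bool \<Rightarrow> 'm"
begin

definition middle_functor where
  "middle_functor = sum_functor (lab \<Phi>) (rhs \<Phi>) weight"

definition \<gamma> :: "'o list \<Rightarrow> 'm" where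
  "\<gamma> As = arr 0 0 False"

definition \<delta> :: "'o list \<Rightarrow> 'm" where
  "\<delta> As = arr 0 0 (0 < level (As ! marked))"

lemma distinct_middle: "distinct (rhs \<Phi>)"
  using \<Phi> by (simp add: is_graph_def)

lemma omap_middle: "omap middle_functor (map \<phi> (rhs \<Phi>)) = obj (height (\<lambda>u. pos (level (\<phi> u))))"
  unfolding middle_functor_def height_def by (rule omap_sum_functor[OF distinct_middle])

lemma mmap_middle: "mmap middle_functor (map w (rhs \<Phi>)) =
    arr (height (\<lambda>u. pos (if lab \<Phi> u = 1 then src (w u) else tgt (w u))))
      (height (\<lambda>u. pos (if lab \<Phi> u = 1 then tgt (w u) else src (w u)))) False"
  unfolding middle_functor_def height_def by (rule mmap_sum_functor[OF distinct_middle])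

lemma middle_functor: "is_functor (places_cat Z (lab \<Phi>) (rhs \<Phi>)) Z middle_functor"
  unfolding middle_functor_def by (rule sum_functor[OF distinct_middle]) (rule weight_sign)

text \<open>Neither side of an equation carries a mark, and both run from \<open>0\<close> to the same number.\<close>

lemma \<gamma>_dinatural: "g_dinatural Z \<Phi> const_functor middle_functor \<gamma>"
  unfolding g_dinatural_def Let_def
proof (intro conjI allI impI ballI)
  fix As :: "'o list"
  have "height (\<lambda>u. pos (level (As ! cidx \<Phi> u))) = 0"
    by (rule height_constant_\<Phi>) simp
  then show "\<gamma> As \<in> Hom Z (omap const_functor (objs \<Phi> As (lhs \<Phi>)))
      (omap middle_functor (objs \<Phi> As (rhs \<Phi>)))"
    by (simp add: \<gamma>_def const_functor_def objs_def omap_middle Hom_iff)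
next
  fix i As f
  assume "f \<in> Mor Z"
  show "Cmp Z (mmap middle_functor (mors Z \<Phi> As i (Idm Z (Cod Z f)) f (rhs \<Phi>)))
          (Cmp Z (\<gamma> (As[i := Cod Z f]))
            (mmap const_functor (mors Z \<Phi> As i f (Idm Z (Cod Z f)) (lhs \<Phi>)))) =
        Cmp Z (mmap middle_functor (mors Z \<Phi> As i f (Idm Z (Dom Z f)) (rhs \<Phi>)))
          (Cmp Z (\<gamma> (As[i := Dom Z f]))
            (mmap const_functor (mors Z \<Phi> As i (Idm Z (Dom Z f)) f (lhs \<Phi>))))"
    unfolding mors_def mmap_middle
    by (auto simp: \<gamma>_def const_functor_def intro!: arr_eqI arg_cong[where f = height])
qed

text \<open>The mark changes only along a morphism from a nonpositive to a positive number in the component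
  \<open>marked\<close>. In that case the two sides of the equation start at a negative number, where there are no
  marks.\<close>

lemma \<delta>_dinatural: "g_dinatural Z \<Psi> middle_functor const_functor \<delta>"
  unfolding g_dinatural_def Let_def
proof (intro conjI allI impI ballI)
  fix As :: "'o list"
  have "height (\<lambda>u. pos (level (As ! cidx \<Psi> u))) = 0"
    by (rule height_constant_\<Psi>) simp
  then show "\<delta> As \<in> Hom Z (omap middle_functor (objs \<Psi> As (lhs \<Psi>)))
      (omap const_functor (objs \<Psi> As (rhs \<Psi>)))"
    by (simp add: \<delta>_def const_functor_def objs_def omap_middle middle Hom_iff)
next
  fix i As f
  assume i: "i < ncomp \<Psi>" and f: "f \<in> Mor Z" and "length As = ncomp \<Psi> \<and> set As \<subseteq> Ob Z"
  then have len: "length As = ncomp \<Psi>" by simp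
  define b where "b u = (if cidx \<Psi> u \<noteq> i then pos (level (As ! cidx \<Psi> u))
      else pos (if lab \<Phi> u = 1 then src f else tgt f))" for u
  have v: "mmap middle_functor (mors Z \<Psi> As i f (Idm Z (Cod Z f)) (lhs \<Psi>)) =
      arr (height b) (height (\<lambda>u. pos (if cidx \<Psi> u \<noteq> i then level (As ! cidx \<Psi> u) else tgt f))) False"
    unfolding mors_def middle mmap_middle
    by (intro arr_eqI) (auto simp: b_def height_def middle_sign intro!: sum.cong)
  have v': "mmap middle_functor (mors Z \<Psi> As i (Idm Z (Dom Z f)) f (lhs \<Psi>)) =
      arr (height b) (height (\<lambda>u. pos (if cidx \<Psi> u \<noteq> i then level (As ! cidx \<Psi> u) else src f))) False"
    unfolding mors_def middle mmap_middle
    by (intro arr_eqI) (auto simp: b_def height_def middle_sign intro!: sum.cong)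
  have "0 < level ((As[i := Cod Z f]) ! marked) \<longleftrightarrow> 0 < level ((As[i := Dom Z f]) ! marked)"
    if "height b = 0"
  proof (cases "i = marked \<and> (0 < src f \<longleftrightarrow> \<not> 0 < tgt f)")
    case True
    then have "pos (src f) = 0" "pos (tgt f) = 1"
      using src_le_tgt[OF f] by (auto simp: pos_def)
    then have "height b < 0"
      using True by (intro height_negative) (auto simp: b_def)
    then show ?thesis using that by simp
  next
    case False
    then show ?thesis
      using i len by (cases "i = marked") auto
  qed
  then show "Cmp Z (mmap const_functor (mors Z \<Psi> As i (Idm Z (Cod Z f)) f (rhs \<Psi>)))
          (Cmp Z (\<delta> (As[i := Cod Z f]))
            (mmap middle_functor (mors Z \<Psi> As i f (Idm Z (Cod Z f)) (lhs \<Psi>)))) =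
        Cmp Z (mmap const_functor (mors Z \<Psi> As i f (Idm Z (Dom Z f)) (rhs \<Psi>)))
          (Cmp Z (\<delta> (As[i := Dom Z f]))
            (mmap middle_functor (mors Z \<Psi> As i (Idm Z (Dom Z f)) f (lhs \<Psi>))))"
    unfolding v v' by (auto simp: \<delta>_def const_functor_def intro!: arr_eqI)
qed

text \<open>The composite at a number is marked if and only if the number is positive, while the step from \<open>0\<close>
  to \<open>1\<close> would require the same value at both.\<close>

lemma composite_not_dinatural:
  "\<not> g_dinatural Z (composition \<Psi> \<Phi>) const_functor const_functor (comp_family Z \<Psi> \<Phi> \<delta> \<gamma>)"
proof
  assume d: "g_dinatural Z (composition \<Psi> \<Phi>) const_functor const_functor (comp_family Z \<Psi> \<Phi> \<delta> \<gamma>)"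
  have m: "marked < ncomp \<Psi>" by (rule marked)
  define f where "f = arr 0 1 False"
  have f: "f \<in> Mor Z" "Dom Z f = obj 0" "Cod Z f = obj 1" by (simp_all add: f_def)
  have "Cmp Z (arr 0 0 False) (Cmp Z (comp_family Z \<Psi> \<Phi> \<delta> \<gamma> [obj 1]) (arr 0 0 False)) =
      Cmp Z (arr 0 0 False) (Cmp Z (comp_family Z \<Psi> \<Phi> \<delta> \<gamma> [obj 0]) (arr 0 0 False))"
    using d[unfolded g_dinatural_def, THEN conjunct2, rule_format, of 0 f "[obj 0]"] f
    by (simp add: Let_def composition_def const_functor_def)
  moreover have "comp_family Z \<Psi> \<Phi> \<delta> \<gamma> [obj x] = arr 0 0 (0 < x)" for x
    using m by (auto simp: comp_family_def \<delta>_def \<gamma>_def intro!: arr_eqI)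
  ultimately have "arr 0 0 True = arr 0 0 False" by simp
  then show False by (metis arr_simps(3))
qed

end

theorem (in composable_graphs) not_provides_if_cycle:
  assumes "\<not> acyclic R" and "infinite (UNIV :: 'o set)" "infinite (UNIV :: 'm set)"
  shows "\<not> provides_g_dinaturality TYPE('o) TYPE('m) \<Phi> \<Psi>"
proof -
  obtain n y where "0 < n" "y n = y 0" "\<And>i. i < n \<Longrightarrow> (y i, y (Suc i)) \<in> R"
    using cycle_of_not_acyclic[OF assms(1)] by blast
  moreover obtain h :: "nat \<Rightarrow> 'o" where "inj h"
    using infinite_countable_subset[OF assms(2)] by blast
  moreover obtain h' :: "nat \<Rightarrow> 'm" where "inj h'"
    using infinite_countable_subset[OF assms(3)] by blast
  ultimately interpret cycle_counterexample \<Phi> \<Psi> n y "h \<circ> to_nat" "h' \<circ> to_nat"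
    by unfold_locales (auto intro: inj_compose)
  show ?thesis
    unfolding provides_g_dinaturality_def
    using Z_category const_functor middle_functor \<gamma>_dinatural \<delta>_dinatural composite_not_dinatural
    by blast
qed

section \<open>The characterization\<close>

theorem theorem2p2:
  fixes \<Phi> \<Psi> :: "'v graph"
  assumes "infinite (UNIV :: 'o set)" and "infinite (UNIV :: 'm set)"
    and "is_graph \<Phi>" and "is_graph \<Psi>"
    and "composable \<Phi> \<Psi>"
    and "card (amalg_components \<Phi> \<Psi>) = 1"
  shows "provides_g_dinaturality TYPE('o) TYPE('m) \<Phi> \<Psi> \<longleftrightarrow>
         \<not> (\<exists>vs es. alternating_loop \<Phi> \<Psi> vs es)"
proof -
  interpret composable_graphs \<Phi> \<Psi>
    using assms(3-5) by unfold_locales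
  have "(\<exists>vs es. alternating_loop \<Phi> \<Psi> vs es) \<longleftrightarrow> \<not> acyclic R"
    using loop_of_cycle cycle_of_loop by blast
  moreover have "provides_g_dinaturality TYPE('o) TYPE('m) \<Phi> \<Psi>" if "acyclic R"
    unfolding provides_g_dinaturality_def using composite_g_dinatural_if_acyclic[OF that] by blast
  moreover have "\<not> provides_g_dinaturality TYPE('o) TYPE('m) \<Phi> \<Psi>" if "\<not> acyclic R"
    using not_provides_if_cycle[OF that assms(1,2)] .
  ultimately show ?thesis by blast
qed

end
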